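(* Let $L$ be a relational language as in the context. Let $\mathcal{M}$ be the generic structure of the amalgamation class $(\mathcal{C}_0(L),\leq)$ and $\hat{\mathcal{M}}$ the generic structure of the amalgamation class $(\hat{\mathcal{C}}_0(L),\leq)$. Then the geometries $G(\mathcal{M})$ and $G(\hat{\mathcal{M}})$ are isomorphic.
   Context: $L$ consists of relation symbols $(R_i:i\in I)$, $I\neq\emptyset$, $R_i$ of arity $n_i\geq 3$, with only finitely many symbols of each arity. $\mathcal{C}_0(L)$ is the class of finite $L$-structures $A$ in which each $R_i^A$ is a set of $n_i$-element subsets of $A$ (symmetric relations) and $\delta(A')\geq0$ for all $A'\subseteq A$, where $\delta(A)=|A|-\sum_i|R_i^A|$ and substructures are induced. $\hat{\mathcal{C}}_0(L)$ is the class of finite $L$-structures $A$ in which each $R_i^A$ is an arbitrary set of $n_i$-tuples of (not necessarily distinct) elements of $A$, with the predimension again $\delta(A)=|A|-\sum_i|R_i^A|$, and $\delta(A')\geq0$ for all $A'\subseteq A$. In either class, for $A\subseteq B$, $A\leq B$ means $\delta(A)\leq\delta(B')$ for all $A\subseteq B'\subseteq B$; for infinite structures all of whose finite substructures are in the class, $A\leq B$ means $\delta(C)\geq\delta(C\cap A)$ for all finite $C\subseteq B$. For finite $A\subseteq B$, $d_B(A)=\min\{\delta(A'):A\subseteq A'\subseteq B\text{ finite}\}$, ${\rm cl}_B(A)=\{c:d_B(A\cup\{c\})=d_B(A)\}$ (extended to infinite sets by unions over finite subsets); $(B,{\rm cl}_B)$ is a pregeometry with associated geometry $G(B)$ (points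 ${\rm cl}_B(x)\setminus{\rm cl}_B(\emptyset)$ for $x\notin{\rm cl}_B(\emptyset)$, induced closure). Both $(\mathcal{C}_0(L),\leq)$ and $(\hat{\mathcal{C}}_0(L),\leq)$ are amalgamation classes (closed under self-sufficient substructures, and any $A\leq B_1,B_2$ can be amalgamated into some $C$ in the class via embeddings with self-sufficient images agreeing on $A$). The generic structure of such a class is the unique-up-to-isomorphism countable structure, all of whose finite substructures are in the class, which is the union of a chain $A_0\leq A_1\leq\cdots$ of members of the class and such that for every finite $A\leq\mathcal{M}$ and $A\leq B$ in the class there is an embedding of $B$ into $\mathcal{M}$ over $A$ with self-sufficient image. *)

theory Defs
  imports "HOL-Library.Infinite_Typeclass" "HOL-Library.Countable_Set"
begin

text \<open>
  The relation symbols are the elements of a type \<open>'i\<close> with arities \<open>ar :: 'i \<Rightarrow> nat\<close>.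
  The two kinds of structures differ only in what a single instance of a relation is:
  a set of points, or a tuple of points that may have repetitions. A value of the
  following type describes one of these: the points that occur in an instance, the action of
  a map of points on instances, and the instances allowed for a symbol of arity \<open>k\<close>.
\<close>

record ('a, 'e) kind =
  supp :: "'e \<Rightarrow> 'a set"
  emap :: "('a \<Rightarrow> 'a) \<Rightarrow> 'e \<Rightarrow> 'e"
  legal :: "nat \<Rightarrow> 'e \<Rightarrow> bool"

definition subsets_kind :: "('a, 'a set) kind" where
  "subsets_kind = \<lparr>supp = (\<lambda>e. e), emap = (\<lambda>f e. f ` e), legal = (\<lambda>k e. finite e \<and> card e = k)\<rparr>"

definition tuples_kind :: "('a, 'a list) kind" where
  "tuples_kind = \<lparr>supp = set, emap = map, legal = (\<lambda>k e. length e = k)\<rparr>"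

record ('a, 'i, 'e) lstruct =
  univ :: "'a set"
  rels :: "'i \<Rightarrow> 'e set"

definition is_lstruct :: "('a, 'e) kind \<Rightarrow> ('i \<Rightarrow> nat) \<Rightarrow> ('a, 'i, 'e) lstruct \<Rightarrow> bool" where
  "is_lstruct K ar A \<longleftrightarrow>
    (\<forall>i. \<forall>e\<in>rels A i. legal K (ar i) e \<and> supp K e \<subseteq> univ A)"

definition induced :: "('a, 'e) kind \<Rightarrow> ('a, 'i, 'e) lstruct \<Rightarrow> 'a set \<Rightarrow> ('a, 'i, 'e) lstruct" where
  "induced K B X = \<lparr>univ = X, rels = (\<lambda>i. {e \<in> rels B i. supp K e \<subseteq> X})\<rparr>"

definition substruct :: "('a, 'e) kind \<Rightarrow> ('a, 'i, 'e) lstruct \<Rightarrow> ('a, 'i, 'e) lstruct \<Rightarrow> bool" where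
  "substruct K A B \<longleftrightarrow> univ A \<subseteq> univ B \<and> A = induced K B (univ A)"

text \<open>The value is meaningful for a finite universe with finitely many relation instances only.\<close>

definition predim :: "('a, 'i, 'e) lstruct \<Rightarrow> int" where
  "predim A = int (card (univ A)) - (\<Sum>i | rels A i \<noteq> {}. int (card (rels A i)))"

text \<open>
  On a finite universe, a structure of tuples can have infinitely many relation instances, when
  there are symbols of infinitely many arities. Its predimension is then \<open>-\<infinity>\<close>, so it
  is not in the class. As \<^const>\<open>sum\<close> and \<^const>\<open>card\<close> are \<open>0\<close> on
  infinite sets, this has to be excluded explicitly.
\<close>

definition in_class :: "('a, 'e) kind \<Rightarrow> ('i \<Rightarrow> nat) \<Rightarrow> ('a, 'i, 'e) lstruct \<Rightarrow> bool" where
  "in_class K ar A \<longleftrightarrow>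
    finite (univ A) \<and> is_lstruct K ar A \<and> finite (SIGMA i:UNIV. rels A i) \<and>
    (\<forall>X\<subseteq>univ A. 0 \<le> predim (induced K A X))"

definition self_sufficient :: "('a, 'e) kind \<Rightarrow> 'a set \<Rightarrow> ('a, 'i, 'e) lstruct \<Rightarrow> bool" where
  "self_sufficient K X B \<longleftrightarrow> X \<subseteq> univ B \<and>
    (if finite (univ B)
     then \<forall>Y. X \<subseteq> Y \<and> Y \<subseteq> univ B \<longrightarrow> predim (induced K B X) \<le> predim (induced K B Y)
     else \<forall>C. finite C \<and> C \<subseteq> univ B \<longrightarrow> predim (induced K B (C \<inter> X)) \<le> predim (induced K B C))"

definition strong_sub :: "('a, 'e) kind \<Rightarrow> ('a, 'i, 'e) lstruct \<Rightarrow> ('a, 'i, 'e) lstruct \<Rightarrow> bool" where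
  "strong_sub K A B \<longleftrightarrow> substruct K A B \<and> self_sufficient K (univ A) B"

definition embedding ::
  "('a, 'e) kind \<Rightarrow> ('a \<Rightarrow> 'a) \<Rightarrow> ('a, 'i, 'e) lstruct \<Rightarrow> ('a, 'i, 'e) lstruct \<Rightarrow> bool" where
  "embedding K f A B \<longleftrightarrow>
    inj_on f (univ A) \<and> f ` univ A \<subseteq> univ B \<and>
    (\<forall>i e. supp K e \<subseteq> univ A \<longrightarrow> (e \<in> rels A i \<longleftrightarrow> emap K f e \<in> rels B i))"

text \<open>
  The sort constraint makes room in \<open>'a\<close> for a copy over \<open>A\<close> of every finite
  extension of a finite structure \<open>A\<close>, so that the last clause is about all extensions in
  the class. It is no loss of generality, as generic structures are infinite.
\<close>

definition generic ::
  "('a::infinite, 'e) kind \<Rightarrow> ('i \<Rightarrow> nat) \<Rightarrow> ('a, 'i, 'e) lstruct \<Rightarrow> bool" where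
  "generic K ar M \<longleftrightarrow>
    is_lstruct K ar M \<and> countable (univ M) \<and>
    (\<forall>X\<subseteq>univ M. finite X \<longrightarrow> in_class K ar (induced K M X)) \<and>
    (\<exists>A :: nat \<Rightarrow> ('a, 'i, 'e) lstruct.
       (\<forall>n. in_class K ar (A n) \<and> strong_sub K (A n) (A (Suc n))) \<and>
       univ M = (\<Union>n. univ (A n)) \<and> (\<forall>i. rels M i = (\<Union>n. rels (A n) i))) \<and>
    (\<forall>A B. finite (univ A) \<and> strong_sub K A M \<and> in_class K ar B \<and> strong_sub K A B \<longrightarrow>
       (\<exists>f. embedding K f B M \<and> (\<forall>a\<in>univ A. f a = a) \<and> self_sufficient K (f ` univ B) M))"

definition dim :: "('a, 'e) kind \<Rightarrow> ('a, 'i, 'e) lstruct \<Rightarrow> 'a set \<Rightarrow> int" where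
  "dim K B X = (LEAST k. \<exists>Y. X \<subseteq> Y \<and> Y \<subseteq> univ B \<and> finite Y \<and> k = predim (induced K B Y))"

definition cl_fin :: "('a, 'e) kind \<Rightarrow> ('a, 'i, 'e) lstruct \<Rightarrow> 'a set \<Rightarrow> 'a set" where
  "cl_fin K B X = {c \<in> univ B. dim K B (insert c X) = dim K B X}"

definition cl :: "('a, 'e) kind \<Rightarrow> ('a, 'i, 'e) lstruct \<Rightarrow> 'a set \<Rightarrow> 'a set" where
  "cl K B X = (if finite X then cl_fin K B X else (\<Union>Y\<in>{Y. finite Y \<and> Y \<subseteq> X}. cl_fin K B Y))"

record 'p geometry =
  points :: "'p set"
  clos :: "'p set \<Rightarrow> 'p set"

definition geom_points :: "('a, 'e) kind \<Rightarrow> ('a, 'i, 'e) lstruct \<Rightarrow> 'a set set" where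
  "geom_points K B = {cl K B {x} - cl K B {} | x. x \<in> univ B \<and> x \<notin> cl K B {}}"

definition geom :: "('a, 'e) kind \<Rightarrow> ('a, 'i, 'e) lstruct \<Rightarrow> 'a set geometry" where
  "geom K B =
    \<lparr>points = geom_points K B, clos = (\<lambda>P. {p \<in> geom_points K B. p \<subseteq> cl K B (\<Union>P)})\<rparr>"

definition geom_iso :: "'p geometry \<Rightarrow> 'q geometry \<Rightarrow> bool" where
  "geom_iso G H \<longleftrightarrow>
    (\<exists>\<phi>. bij_betw \<phi> (points G) (points H) \<and>
      (\<forall>P\<subseteq>points G. \<phi> ` clos G P = clos H (\<phi> ` P)))"

end

theory Submission
  imports Defs
begin

text \<open>
  The proof is a back-and-forth between the two generic structures along bijections of finite
  self-sufficient subsets that preserve dimension. Dimension only depends on the supports of the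
  relation instances, and replacing the structure on a subset by one with the same dimension
  function does not change the dimension of the whole. An extension in \<open>M\<close> is copied to
  \<open>M_hat\<close> by listing every new set as a tuple. Conversely, an extension in \<open>M_hat\<close> may
  have tuples with repetitions, or several tuples on the same points. It is first enlarged inside
  \<open>M_hat\<close> by auxiliary points: points of dimension 0 for padding, and points parallel to old
  ones. The enlarged structure has the same dimension function as one all of whose new instances
  are distinct sets of the right size.
\<close>

section \<open>Predimensions of induced substructures\<close>

text \<open>Predimensions themselves cannot be matched: a constant tuple can give a single point of
  \<open>M_hat\<close> predimension 0, whereas instances in \<open>M\<close> have at least three
  points, so there a set of at most two points has its cardinality as predimension. Only minima over
  supersets can agree, and in \<open>M\<close> a point of dimension 0 needs further points that
  witness this. The witnesses enter the domain of a bijection, so \<open>M_hat\<close> has to supply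
  partners for them; its own genericity does so.

  The witnesses for arity n are n + 1 points with all their n-element subsets as edges. Edges and
  points are equal in number, so the whole has predimension 0, while a proper subset contains at
  most one edge. One more edge through n - 2 of these points makes its two remaining points
  parallel.

  A copied extension must also be shown to lie in the class and to have a self-sufficient base. Both
  are inherited from the other generic structure: each value of the new predimension is bounded
  below by a value known there.\<close>

definition edges :: "('a, 'e) kind \<Rightarrow> ('a, 'i, 'e) lstruct \<Rightarrow> 'a set \<Rightarrow> ('i \<times> 'e) set" where
  "edges K B Y = {(i, e). e \<in> rels B i \<and> supp K e \<subseteq> Y}"

text \<open>Counting pairs of a symbol and an instance gives one cardinality in place of the sum
  over symbols; it agrees with \<open>predim\<close> once these pairs are finitely many.\<close>

definition delta :: "('a, 'e) kind \<Rightarrow> ('a, 'i, 'e) lstruct \<Rightarrow> 'a set \<Rightarrow> int" where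
  "delta K B Y = int (card Y) - int (card (edges K B Y))"

lemma mem_edges: "(i, e) \<in> edges K B Y \<longleftrightarrow> e \<in> rels B i \<and> supp K e \<subseteq> Y"
  by (simp add: edges_def)

lemma edges_mono: "X \<subseteq> Y \<Longrightarrow> edges K B X \<subseteq> edges K B Y"
  by (auto simp: edges_def)

lemma predim_induced:
  assumes "finite (edges K B Y)"
  shows "predim (induced K B Y) = delta K B Y"
proof -
  let ?R = "\<lambda>i. {e \<in> rels B i. supp K e \<subseteq> Y}"
  let ?S = "{i. ?R i \<noteq> {}}"
  have edges: "edges K B Y = Sigma ?S ?R"
    by (auto simp: edges_def)
  have S: "?S = fst ` edges K B Y"
    by (force simp: edges_def)
  have "finite ?S"
    unfolding S using assms by simp
  moreover have "finite (?R i)" for i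
    by (rule finite_subset[OF _ finite_imageI[OF assms, of snd]]) (force simp: edges_def)
  ultimately have "card (edges K B Y) = (\<Sum>i\<in>?S. card (?R i))"
    unfolding edges by (subst card_SigmaI) auto
  then show ?thesis
    by (simp add: predim_def induced_def delta_def)
qed

text \<open>Instances inside \<open>X\<close> or inside \<open>Y\<close> are inside the union, and
  those inside both are exactly those inside the intersection. Only instances that straddle the two
  sets make the inequality strict.\<close>

lemma delta_submodular:
  assumes "finite X" "finite Y" "finite (edges K B (X \<union> Y))"
  shows "delta K B (X \<union> Y) + delta K B (X \<inter> Y) \<le> delta K B X + delta K B Y"
proof -
  have fin: "finite (edges K B X)" "finite (edges K B Y)"
    using assms(3) edges_mono[of X "X \<union> Y" K B] edges_mono[of Y "X \<union> Y" K B]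
    by (auto intro: finite_subset)
  have "card (edges K B X \<union> edges K B Y) \<le> card (edges K B (X \<union> Y))"
    by (rule card_mono[OF assms(3)]) (auto simp: edges_def)
  moreover have "edges K B X \<inter> edges K B Y = edges K B (X \<inter> Y)"
    by (auto simp: edges_def)
  ultimately show ?thesis
    using card_Un_Int[OF assms(1,2)] card_Un_Int[OF fin] by (simp add: delta_def)
qed

section \<open>Finite self-sufficient sets\<close>

definition nonneg_predim :: "('a, 'e) kind \<Rightarrow> ('a, 'i, 'e) lstruct \<Rightarrow> bool" where
  "nonneg_predim K B \<longleftrightarrow>
    (\<forall>Y\<subseteq>univ B. finite Y \<longrightarrow> finite (edges K B Y) \<and> 0 \<le> delta K B Y)"

text \<open>The superset form of self-sufficiency, for finite and infinite ambient structures alike.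
  \<open>closed_in_Int\<close> recovers the intersection form that \<open>self_sufficient\<close>
  uses for infinite ones.\<close>

definition closed_in :: "('a, 'e) kind \<Rightarrow> ('a, 'i, 'e) lstruct \<Rightarrow> 'a set \<Rightarrow> bool" where
  "closed_in K B X \<longleftrightarrow> finite X \<and> X \<subseteq> univ B \<and>
    (\<forall>Y. finite Y \<and> X \<subseteq> Y \<and> Y \<subseteq> univ B \<longrightarrow> delta K B X \<le> delta K B Y)"

text \<open>By submodularity, passing from \<open>C \<inter> X\<close> to \<open>C\<close> costs at
  least as much as passing from \<open>X\<close> to \<open>C \<union> X\<close>, and the latter cost
  is nonnegative.\<close>

lemma closed_in_Int:
  assumes "nonneg_predim K B" "closed_in K B X" "finite C" "C \<subseteq> univ B"
  shows "delta K B (C \<inter> X) \<le> delta K B C"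
proof -
  have X: "finite X" "X \<subseteq> univ B"
    using assms(2) by (auto simp: closed_in_def)
  then have "finite (edges K B (C \<union> X))"
    using assms by (auto simp: nonneg_predim_def)
  then have "delta K B (C \<union> X) + delta K B (C \<inter> X) \<le> delta K B C + delta K B X"
    using assms X by (intro delta_submodular) auto
  moreover have "delta K B X \<le> delta K B (C \<union> X)"
    using assms(2-4) by (auto simp: closed_in_def)
  ultimately show ?thesis by simp
qed

lemma self_sufficient_iff_closed_in:
  assumes "nonneg_predim K B" "finite X"
  shows "self_sufficient K X B \<longleftrightarrow> closed_in K B X"
proof -
  have predim: "predim (induced K B Y) = delta K B Y" if "finite Y" "Y \<subseteq> univ B" for Y
    using assms(1) that by (intro predim_induced) (auto simp: nonneg_predim_def)
  show ?thesis
  proof (cases "finite (univ B)")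
    case True
    then have fin: "finite Y" if "Y \<subseteq> univ B" for Y
      using that finite_subset by blast
    have "self_sufficient K X B \<longleftrightarrow> X \<subseteq> univ B \<and>
        (\<forall>Y. X \<subseteq> Y \<and> Y \<subseteq> univ B \<longrightarrow> delta K B X \<le> delta K B Y)"
      unfolding self_sufficient_def using True fin predim by (simp cong: conj_cong imp_cong)
    then show ?thesis
      unfolding closed_in_def using assms(2) fin by metis
  next
    case False
    show ?thesis
    proof
      assume L: "self_sufficient K X B"
      have "delta K B X \<le> delta K B Y" if "finite Y" "X \<subseteq> Y" "Y \<subseteq> univ B" for Y
      proof -
        have "predim (induced K B (Y \<inter> X)) \<le> predim (induced K B Y)"
          using L False that by (simp add: self_sufficient_def)
        then show ?thesis
          using that assms(2) predim[of X] predim[of Y] by (simp add: Int_absorb1)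
      qed
      then show "closed_in K B X"
        using L assms(2) by (auto simp: self_sufficient_def closed_in_def)
    next
      assume R: "closed_in K B X"
      have "predim (induced K B (C \<inter> X)) \<le> predim (induced K B C)"
        if "finite C" "C \<subseteq> univ B" for C
      proof -
        have "predim (induced K B (C \<inter> X)) = delta K B (C \<inter> X)"
          using that by (intro predim) auto
        then show ?thesis
          using closed_in_Int[OF assms(1) R that] predim that by simp
      qed
      then show "self_sufficient K X B"
        using R False by (simp add: self_sufficient_def closed_in_def)
    qed
  qed
qed

section \<open>Minima of the predimension\<close>

lemma exists_least_nonneg_int:
  fixes S :: "int set"
  assumes "S \<noteq> {}" "\<And>k. k \<in> S \<Longrightarrow> 0 \<le> k"
  shows "\<exists>m\<in>S. \<forall>k\<in>S. m \<le> k"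
proof -
  obtain k0 where "k0 \<in> S" using assms(1) by blast
  then obtain m where "m \<in> S" "\<And>k. k \<in> S \<Longrightarrow> nat m \<le> nat k"
    using ex_has_least_nat[of "\<lambda>k. k \<in> S" k0 nat] by blast
  then show ?thesis
    using assms(2) by (intro bexI[of _ m] ballI) (simp_all add: nat_le_eq_zle)
qed

lemma exists_least_delta:
  assumes "nonneg_predim K B" "finite X" "X \<subseteq> univ B"
  obtains Y where "finite Y" "X \<subseteq> Y" "Y \<subseteq> univ B"
    "\<forall>Z. finite Z \<and> X \<subseteq> Z \<and> Z \<subseteq> univ B \<longrightarrow> delta K B Y \<le> delta K B Z"
proof -
  let ?S = "delta K B ` {Y. finite Y \<and> X \<subseteq> Y \<and> Y \<subseteq> univ B}"
  have "\<exists>m\<in>?S. \<forall>k\<in>?S. m \<le> k"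
    using assms by (intro exists_least_nonneg_int) (auto simp: nonneg_predim_def)
  then obtain Y where "finite Y" "X \<subseteq> Y" "Y \<subseteq> univ B" "\<forall>k\<in>?S. delta K B Y \<le> k"
    by auto
  then show ?thesis
    by (intro that[of Y]) simp_all
qed

text \<open>A superset of least predimension is self-sufficient, because its own supersets took part
  in the same minimum.\<close>

lemma exists_closed_in_superset:
  assumes "nonneg_predim K B" "finite X" "X \<subseteq> univ B"
  obtains Y where "X \<subseteq> Y" "closed_in K B Y"
proof -
  obtain Y where Y: "finite Y" "X \<subseteq> Y" "Y \<subseteq> univ B"
    "\<forall>Z. finite Z \<and> X \<subseteq> Z \<and> Z \<subseteq> univ B \<longrightarrow> delta K B Y \<le> delta K B Z"
    by (rule exists_least_delta[OF assms])
  then have "closed_in K B Y"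
    unfolding closed_in_def using order_trans[OF \<open>X \<subseteq> Y\<close>] by simp
  with Y(2) show ?thesis by (rule that)
qed

text \<open>\<open>LEAST\<close> on integers is informative only when a minimum exists;
  nonnegativity guarantees one.\<close>

lemma dim_attained:
  assumes "nonneg_predim K B" "finite X" "X \<subseteq> univ B"
  shows "\<exists>Y. finite Y \<and> X \<subseteq> Y \<and> Y \<subseteq> univ B \<and> dim K B X = delta K B Y"
    and "\<And>Z. finite Z \<Longrightarrow> X \<subseteq> Z \<Longrightarrow> Z \<subseteq> univ B \<Longrightarrow> dim K B X \<le> delta K B Z"
proof -
  obtain Y where Y: "finite Y" "X \<subseteq> Y" "Y \<subseteq> univ B"
    and min: "\<forall>Z. finite Z \<and> X \<subseteq> Z \<and> Z \<subseteq> univ B \<longrightarrow> delta K B Y \<le> delta K B Z"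
    by (rule exists_least_delta[OF assms])
  have predim: "predim (induced K B Z) = delta K B Z" if "finite Z" "Z \<subseteq> univ B" for Z
    using assms(1) that by (intro predim_induced) (auto simp: nonneg_predim_def)
  have "dim K B X = delta K B Y"
    unfolding dim_def
  proof (rule Least_equality)
    show "\<exists>Z. X \<subseteq> Z \<and> Z \<subseteq> univ B \<and> finite Z \<and> delta K B Y = predim (induced K B Z)"
      using Y predim by (intro exI[of _ Y]) simp
  next
    fix k assume "\<exists>Z. X \<subseteq> Z \<and> Z \<subseteq> univ B \<and> finite Z \<and> k = predim (induced K B Z)"
    then obtain Z where "X \<subseteq> Z" "Z \<subseteq> univ B" "finite Z" "k = predim (induced K B Z)"
      by (elim exE conjE)
    then show "delta K B Y \<le> k"
      using min predim by simp
  qed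
  then show "\<exists>Y. finite Y \<and> X \<subseteq> Y \<and> Y \<subseteq> univ B \<and> dim K B X = delta K B Y"
    and "\<And>Z. finite Z \<Longrightarrow> X \<subseteq> Z \<Longrightarrow> Z \<subseteq> univ B \<Longrightarrow> dim K B X \<le> delta K B Z"
    using Y min by (simp_all, intro exI[of _ Y], simp)
qed

section \<open>Consequences of genericity for finite sets\<close>

lemma edges_eq_Sigma_induced:
  "edges K B Y = (SIGMA i:UNIV. rels (induced K B Y) i)"
  by (auto simp: edges_def induced_def)

lemma generic_in_class:
  assumes "generic K ar M" "X \<subseteq> univ M" "finite X"
  shows "in_class K ar (induced K M X)"
proof -
  have "\<forall>X\<subseteq>univ M. finite X \<longrightarrow> in_class K ar (induced K M X)"
    using assms(1) unfolding generic_def by (elim conjE) assumption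
  then show ?thesis
    using assms(2,3) by simp
qed

lemma generic_nonneg_predim:
  assumes "generic K ar M"
  shows "nonneg_predim K M"
  unfolding nonneg_predim_def
proof (intro allI impI)
  fix Y assume Y: "Y \<subseteq> univ M" "finite Y"
  then have C: "in_class K ar (induced K M Y)"
    using generic_in_class[OF assms] by simp
  then have fin: "finite (edges K M Y)"
    by (simp add: in_class_def edges_eq_Sigma_induced)
  have "\<forall>X\<subseteq>univ (induced K M Y). 0 \<le> predim (induced K (induced K M Y) X)"
    using C unfolding in_class_def by (elim conjE) assumption
  moreover have "univ (induced K M Y) = Y"
    by (simp add: induced_def)
  ultimately have "0 \<le> predim (induced K (induced K M Y) Y)"
    by simp
  moreover have "induced K (induced K M Y) Y = induced K M Y"
    by (auto simp: induced_def)
  ultimately show "finite (edges K M Y) \<and> 0 \<le> delta K M Y"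
    using fin predim_induced[OF fin] by simp
qed

lemma generic_embed:
  assumes "generic K ar M" "finite (univ A)" "strong_sub K A M" "in_class K ar B" "strong_sub K A B"
  shows "\<exists>f. embedding K f B M \<and> (\<forall>a\<in>univ A. f a = a) \<and> self_sufficient K (f ` univ B) M"
proof -
  have "\<forall>A B. finite (univ A) \<and> strong_sub K A M \<and> in_class K ar B \<and> strong_sub K A B \<longrightarrow>
      (\<exists>f. embedding K f B M \<and> (\<forall>a\<in>univ A. f a = a) \<and> self_sufficient K (f ` univ B) M)"
    using assms(1) unfolding generic_def by (elim conjE) assumption
  then show ?thesis
    using assms(2-5) by simp
qed

lemma nonneg_predimD:
  assumes "nonneg_predim K B" "finite Y" "Y \<subseteq> univ B"
  shows "finite (edges K B Y)" "0 \<le> delta K B Y"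
  using assms by (simp_all add: nonneg_predim_def)

lemma delta_empty:
  assumes "nonneg_predim K B"
  shows "delta K B {} = 0"
proof -
  have "0 \<le> delta K B {}"
    using assms by (rule nonneg_predimD) simp_all
  then show ?thesis
    by (simp add: delta_def)
qed

lemma closed_in_empty:
  assumes "nonneg_predim K B"
  shows "closed_in K B {}"
  unfolding closed_in_def using nonneg_predimD(2)[OF assms] delta_empty[OF assms] by simp

section \<open>Realising abstract extensions in a generic structure\<close>

text \<open>These laws make an embedding act bijectively on the edges inside a set and its image, so
  that both kinds of structures share all counting arguments.\<close>

locale kind_laws =
  fixes K :: "('a::infinite, 'e) kind"
  assumes supp_emap: "supp K (emap K f e) = f ` supp K e"
    and emap_inj: "\<lbrakk>inj_on f S; supp K e \<subseteq> S; supp K e' \<subseteq> S; emap K f e = emap K f e'\<rbrakk> \<Longrightarrow> e = e'"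
    and emap_surj: "supp K e \<subseteq> f ` S \<Longrightarrow> \<exists>e'. supp K e' \<subseteq> S \<and> emap K f e' = e"

interpretation subsets: kind_laws subsets_kind
proof
  fix f :: "'a \<Rightarrow> 'a" and S e e'
  show "supp subsets_kind (emap subsets_kind f e) = f ` supp subsets_kind e"
    by (simp add: subsets_kind_def)
  show "\<lbrakk>inj_on f S; supp subsets_kind e \<subseteq> S; supp subsets_kind e' \<subseteq> S;
      emap subsets_kind f e = emap subsets_kind f e'\<rbrakk> \<Longrightarrow> e = e'"
    by (simp add: subsets_kind_def inj_on_image_eq_iff)
  show "supp subsets_kind e \<subseteq> f ` S \<Longrightarrow>
      \<exists>e'. supp subsets_kind e' \<subseteq> S \<and> emap subsets_kind f e' = e"
    by (auto simp: subsets_kind_def subset_image_iff)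
qed

interpretation tuples: kind_laws tuples_kind
proof
  fix f :: "'a \<Rightarrow> 'a" and S e e'
  show "supp tuples_kind (emap tuples_kind f e) = f ` supp tuples_kind e"
    by (simp add: tuples_kind_def)
  show "\<lbrakk>inj_on f S; supp tuples_kind e \<subseteq> S; supp tuples_kind e' \<subseteq> S;
      emap tuples_kind f e = emap tuples_kind f e'\<rbrakk> \<Longrightarrow> e = e'"
    by (auto simp: tuples_kind_def intro: map_inj_on inj_on_subset)
  show "\<exists>e'. supp tuples_kind e' \<subseteq> S \<and> emap tuples_kind f e' = e"
    if "supp tuples_kind e \<subseteq> f ` S"
  proof (intro exI conjI)
    show "supp tuples_kind (map (inv_into S f) e) \<subseteq> S"
      using that by (auto simp: tuples_kind_def inv_into_into)
    show "emap tuples_kind f (map (inv_into S f) e) = e"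
      using that by (auto simp: tuples_kind_def f_inv_into_f intro!: map_idI)
  qed
qed

text \<open>
  The predimension on subsets of an abstract vertex set: \<open>\<alpha>\<close> is the predimension of the base
  \<open>W\<close>, and \<open>J\<close> indexes the additional edges, with supports \<open>s\<close>.
\<close>

definition ext_delta ::
  "'v set \<Rightarrow> ('v set \<Rightarrow> int) \<Rightarrow> ('j \<Rightarrow> 'v set) \<Rightarrow> 'j set \<Rightarrow> 'v set \<Rightarrow> int" where
  "ext_delta W \<alpha> s J Y = \<alpha> (Y \<inter> W) + int (card (Y - W)) - int (card {j \<in> J. s j \<subseteq> Y})"

lemma inj_on_image_subset_iff:
  assumes "inj_on g V" "X \<subseteq> V" "Y \<subseteq> V"
  shows "g ` X \<subseteq> g ` Y \<longleftrightarrow> X \<subseteq> Y"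
proof
  assume L: "g ` X \<subseteq> g ` Y"
  show "X \<subseteq> Y"
  proof
    fix x assume "x \<in> X"
    with L have "g x \<in> g ` Y" by blast
    then show "x \<in> Y"
      using inj_on_image_mem_iff[OF assms(1), of x Y] \<open>x \<in> X\<close> assms(2,3) by blast
  qed
qed blast

text \<open>\<open>generic\<close> quantifies only over extensions in the type of the structure, so
  abstract vertices must first become points of that type; being infinite, it has room for the fresh
  ones.\<close>

lemma extend_injection:
  assumes "finite V" "W \<subseteq> V" "inj_on g0 W"
  shows "\<exists>g :: 'v \<Rightarrow> 'a::infinite. inj_on g V \<and> (\<forall>x\<in>W. g x = g0 x)"
proof -
  have fin: "finite (g0 ` W)"
    using assms finite_subset by blast
  obtain T where T: "T \<subseteq> UNIV - g0 ` W" "finite T" "card T = card (V - W)"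
    using infinite_arbitrarily_large[of "UNIV - g0 ` W"] infinite_UNIV fin
    by (metis Diff_infinite_finite)
  obtain h where h: "bij_betw h (V - W) T"
    using finite_same_card_bij[of "V - W" T] T assms(1) by auto
  let ?g = "\<lambda>x. if x \<in> W then g0 x else h x"
  have "inj_on ?g (W \<union> (V - W))"
    using assms(3) h T(1)
    by (subst inj_on_Un) (auto simp: bij_betw_def inj_on_def)
  then show ?thesis
    using assms(2) by (intro exI[of _ ?g]) (simp add: Un_absorb1 Un_Diff_cancel)
qed

context kind_laws
begin

lemma delta_embedding:
  assumes "embedding K f B N" "Y \<subseteq> univ B"
  shows "delta K N (f ` Y) = delta K B Y"
proof -
  have inj: "inj_on f Y"
    using assms by (auto simp: embedding_def intro: inj_on_subset)
  let ?F = "\<lambda>(i, e). (i, emap K f e)"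
  have "?F ` edges K B Y = edges K N (f ` Y)"
  proof (intro equalityI subsetI)
    fix x assume "x \<in> ?F ` edges K B Y"
    then obtain i e where "x = (i, emap K f e)" "e \<in> rels B i" "supp K e \<subseteq> Y"
      by (auto simp: edges_def)
    then show "x \<in> edges K N (f ` Y)"
      using assms by (fastforce simp: embedding_def mem_edges supp_emap)
  next
    fix x assume "x \<in> edges K N (f ` Y)"
    then obtain i e where x: "x = (i, e)" "e \<in> rels N i" "supp K e \<subseteq> f ` Y"
      by (auto simp: edges_def)
    then obtain e' where e': "supp K e' \<subseteq> Y" "emap K f e' = e"
      using emap_surj by blast
    then have "e' \<in> rels B i"
      using assms x by (auto simp: embedding_def)
    with e' x show "x \<in> ?F ` edges K B Y"
      by (intro image_eqI[of _ _ "(i, e')"]) (auto simp: mem_edges)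
  qed
  moreover have "inj_on ?F (edges K B Y)"
    using emap_inj[OF inj] by (auto simp: inj_on_def edges_def)
  ultimately have "card (edges K N (f ` Y)) = card (edges K B Y)"
    by (metis card_image)
  then show ?thesis
    by (simp add: delta_def card_image[OF inj])
qed

text \<open>The extension property for extensions given only by vertices and supports.
  \<open>E\<close> takes the injection as an argument because an instance can be written down only
  after the vertices have become points. \<open>sW\<close> keeps the base an induced substructure,
  \<open>s_inj\<close> keeps indices from collapsing to one instance, \<open>nonneg\<close> yields
  membership in the class and \<open>minimal\<close> self-sufficiency of the base.\<close>

lemma generic_extend:
  fixes E :: "('v \<Rightarrow> 'a) \<Rightarrow> 'j \<Rightarrow> 'e" and N :: "('a, 'i, 'e) lstruct" and symb :: "'j \<Rightarrow> 'i"
  assumes gen: "generic K ar N"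
    and V: "finite V" "W \<subseteq> V" and J: "finite J"
    and g0: "inj_on g0 W" "closed_in K N (g0 ` W)"
    and sV: "\<And>j. j \<in> J \<Longrightarrow> s j \<subseteq> V" and sW: "\<And>j. j \<in> J \<Longrightarrow> \<not> s j \<subseteq> W"
    and E: "\<And>g j. inj_on g V \<Longrightarrow> j \<in> J \<Longrightarrow> legal K (ar (symb j)) (E g j) \<and> supp K (E g j) = g ` s j"
    and s_inj: "inj_on (\<lambda>j. (symb j, s j)) J"
    and nonneg: "\<And>Y. Y \<subseteq> V \<Longrightarrow> 0 \<le> ext_delta W (\<lambda>X. delta K N (g0 ` X)) s J Y"
    and minimal: "\<And>Y. W \<subseteq> Y \<Longrightarrow> Y \<subseteq> V \<Longrightarrow>
      delta K N (g0 ` W) \<le> ext_delta W (\<lambda>X. delta K N (g0 ` X)) s J Y"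
  shows "\<exists>h. inj_on h V \<and> (\<forall>x\<in>W. h x = g0 x) \<and> closed_in K N (h ` V) \<and>
    (\<forall>Y\<subseteq>V. delta K N (h ` Y) = ext_delta W (\<lambda>X. delta K N (g0 ` X)) s J Y)"
proof -
  let ?\<Delta> = "ext_delta W (\<lambda>X. delta K N (g0 ` X)) s J"
  have nn: "nonneg_predim K N"
    using gen by (rule generic_nonneg_predim)
  obtain g where g: "inj_on g V" and g_g0: "\<And>x. x \<in> W \<Longrightarrow> g x = g0 x"
    using extend_injection[OF V g0(1)] by blast
  have finW: "finite W"
    using V finite_subset by blast
  have gW: "g ` W = g0 ` W"
    using g_g0 by (intro image_cong) auto
  have WN: "g0 ` W \<subseteq> univ N"
    using g0(2) by (simp add: closed_in_def)
  let ?new = "\<lambda>j. (symb j, E g j)"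
  define A where "A = induced K N (g0 ` W)"
  define B where "B = \<lparr>univ = g ` V,
    rels = (\<lambda>i. {e \<in> rels N i. supp K e \<subseteq> g0 ` W} \<union> {E g j | j. j \<in> J \<and> symb j = i})\<rparr>"
  have g_sub: "g ` X \<subseteq> g ` Y \<longleftrightarrow> X \<subseteq> Y" if "X \<subseteq> V" "Y \<subseteq> V" for X Y
    using g that by (rule inj_on_image_subset_iff)
  have new_inj: "inj_on ?new J"
  proof (rule inj_onI)
    fix j j' assume j: "j \<in> J" "j' \<in> J" and eq: "?new j = ?new j'"
    then have "g ` s j = g ` s j'"
      using E[OF g j(1)] E[OF g j(2)] by simp
    then have "s j = s j'"
      using inj_on_image_eq_iff[OF g sV[OF j(1)] sV[OF j(2)]] by simp
    with eq j show "j = j'"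
      using s_inj by (simp add: inj_on_def)
  qed
  have edges_B: "edges K B (g ` Y) = edges K N (g0 ` (Y \<inter> W)) \<union> ?new ` {j \<in> J. s j \<subseteq> Y}"
    (is "?L = ?R") if Y: "Y \<subseteq> V" for Y
  proof -
    have int: "g ` Y \<inter> g0 ` W = g0 ` (Y \<inter> W)"
    proof -
      have "g ` Y \<inter> g ` W = g ` (Y \<inter> W)"
        using inj_on_image_Int[OF g Y V(2)] by simp
      also have "\<dots> = g0 ` (Y \<inter> W)"
        using g_g0 by (intro image_cong) auto
      finally show ?thesis by (simp add: gW)
    qed
    have new: "supp K (E g j) \<subseteq> g ` Y \<longleftrightarrow> s j \<subseteq> Y" if "j \<in> J" for j
      using E[OF g that] g_sub[OF sV[OF that] Y] by simp
    have "(i, e) \<in> ?L \<longleftrightarrow> (i, e) \<in> ?R" for i e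
      using new by (auto simp: mem_edges B_def int[symmetric])
    then show ?thesis by auto
  qed
  have fin_old: "finite (edges K N (g0 ` (Y \<inter> W)))" for Y
    using nn finW WN by (simp add: nonneg_predim_def image_subset_iff)
  have fin_B: "finite (edges K B (g ` Y))" if "Y \<subseteq> V" for Y
    using fin_old J by (simp add: edges_B[OF that])
  have delta_B: "delta K B (g ` Y) = ?\<Delta> Y" if Y: "Y \<subseteq> V" for Y
  proof -
    have "edges K N (g0 ` (Y \<inter> W)) \<inter> ?new ` {j \<in> J. s j \<subseteq> Y} = {}"
    proof -
      have "\<not> supp K (E g j) \<subseteq> g0 ` (Y \<inter> W)" if "j \<in> J" for j
      proof
        assume "supp K (E g j) \<subseteq> g0 ` (Y \<inter> W)"
        then have "g ` s j \<subseteq> g ` W"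
          using E[OF g that] gW by auto
        then show False
          using g_sub[OF sV[OF that] V(2)] sW[OF that] by simp
      qed
      then show ?thesis by (auto simp: mem_edges)
    qed
    then have "card (edges K B (g ` Y))
        = card (edges K N (g0 ` (Y \<inter> W))) + card (?new ` {j \<in> J. s j \<subseteq> Y})"
      unfolding edges_B[OF Y] using fin_old J by (intro card_Un_disjoint) auto
    moreover have "card (?new ` {j \<in> J. s j \<subseteq> Y}) = card {j \<in> J. s j \<subseteq> Y}"
      by (intro card_image inj_on_subset[OF new_inj]) auto
    moreover have "card (g ` Y) = card Y"
      using card_image inj_on_subset[OF g Y] by blast
    moreover have "card (g0 ` (Y \<inter> W)) = card (Y \<inter> W)"
      by (intro card_image inj_on_subset[OF g0(1)]) auto
    moreover have "card Y = card (Y \<inter> W) + card (Y - W)"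
      using card_Int_Diff[of Y W] finite_subset[OF Y V(1)] by simp
    ultimately show ?thesis
      unfolding delta_def ext_delta_def by linarith
  qed
  have univ_B: "univ B = g ` V"
    by (simp add: B_def)
  have nn_B: "nonneg_predim K B"
    unfolding nonneg_predim_def
  proof (intro allI impI)
    fix X assume "X \<subseteq> univ B"
    then obtain Y where "Y \<subseteq> V" "X = g ` Y"
      unfolding univ_B by (metis subset_imageE)
    then show "finite (edges K B X) \<and> 0 \<le> delta K B X"
      using fin_B delta_B nonneg by simp
  qed
  have rels_B: "legal K (ar i) e \<and> supp K e \<subseteq> g ` V" if "e \<in> rels B i" for i e
  proof -
    from that consider "e \<in> rels N i" "supp K e \<subseteq> g ` W" | j where "j \<in> J" "symb j = i" "e = E g j"
      by (auto simp: B_def gW)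
    then show ?thesis
    proof cases
      case 1
      then have "legal K (ar i) e"
        using gen by (simp add: generic_def is_lstruct_def)
      moreover have "supp K e \<subseteq> g ` V"
        using 1(2) V(2) by blast
      ultimately show ?thesis ..
    next
      case 2
      then show ?thesis
        using E[OF g 2(1)] sV[OF 2(1)] by (simp add: image_mono)
    qed
  qed
  have class_B: "in_class K ar B"
    unfolding in_class_def
  proof (intro conjI allI impI)
    show "finite (univ B)"
      using V by (simp add: B_def)
    show "is_lstruct K ar B"
      using rels_B by (simp add: is_lstruct_def univ_B)
    have "(SIGMA i:UNIV. rels B i) \<subseteq> edges K B (g ` V)"
      using rels_B by (auto simp: mem_edges)
    then show "finite (SIGMA i:UNIV. rels B i)"
      using fin_B[of V] finite_subset by blast
    fix X assume X: "X \<subseteq> univ B"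
    then have "finite (edges K B X)" "0 \<le> delta K B X"
      using nn_B finite_subset[OF X] V(1) by (simp_all add: nonneg_predim_def univ_B)
    then show "0 \<le> predim (induced K B X)"
      by (simp add: predim_induced)
  qed
  have rels_W: "{e \<in> rels B i. supp K e \<subseteq> g0 ` W} = {e \<in> rels N i. supp K e \<subseteq> g0 ` W}" for i
  proof -
    have "\<not> supp K (E g j) \<subseteq> g0 ` W" if "j \<in> J" for j
      using E[OF g that] sW[OF that] g_sub[OF sV[OF that] V(2)] by (simp add: gW[symmetric])
    then show ?thesis by (auto simp: B_def)
  qed
  have AN: "strong_sub K A N"
    using g0(2) WN self_sufficient_iff_closed_in[OF nn, of "g0 ` W"] finW
    by (simp add: strong_sub_def substruct_def A_def induced_def)
  have "delta K B (g ` W) \<le> delta K B X" if X: "g ` W \<subseteq> X" "X \<subseteq> univ B" for X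
  proof -
    obtain Y where Y: "Y \<subseteq> V" "X = g ` Y"
      using X(2) unfolding univ_B by (metis subset_imageE)
    then have "W \<subseteq> Y"
      using X(1) g_sub[OF V(2)] by simp
    then have "delta K N (g0 ` W) \<le> ?\<Delta> Y"
      using minimal Y(1) by simp
    moreover have "{j \<in> J. s j \<subseteq> W} = {}"
      using sW by auto
    then have "?\<Delta> W = delta K N (g0 ` W)"
      unfolding ext_delta_def by (simp only: Int_absorb Diff_cancel card.empty of_nat_0 add_0_right diff_zero)
    ultimately show ?thesis
      using delta_B[OF V(2)] delta_B[OF Y(1)] Y(2) by simp
  qed
  then have "closed_in K B (g0 ` W)"
    using finW V(2) by (simp add: closed_in_def gW[symmetric] univ_B image_mono)
  then have AB: "strong_sub K A B"
    using self_sufficient_iff_closed_in[OF nn_B, of "g0 ` W"] finW rels_W image_mono[OF V(2), of g] gW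
    by (simp add: strong_sub_def substruct_def A_def induced_def univ_B)
  have "finite (univ A)"
    using finW by (simp add: A_def induced_def)
  then obtain f where f: "embedding K f B N" "\<And>a. a \<in> univ A \<Longrightarrow> f a = a"
      "self_sufficient K (f ` univ B) N"
    using generic_embed[OF gen _ AN class_B AB] by blast
  have "inj_on f (g ` V)"
    using f(1) by (simp add: embedding_def univ_B)
  then have "inj_on (f \<circ> g) V"
    using g by (intro comp_inj_on)
  moreover have "(f \<circ> g) x = g0 x" if "x \<in> W" for x
    using f(2)[of "g0 x"] g_g0[OF that] that by (simp add: A_def induced_def)
  moreover have "closed_in K N ((f \<circ> g) ` V)"
    using f(3) self_sufficient_iff_closed_in[OF nn] V(1) by (simp add: univ_B image_comp)
  moreover have "delta K N ((f \<circ> g) ` Y) = ?\<Delta> Y" if "Y \<subseteq> V" for Y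
    using delta_embedding[OF f(1), of "g ` Y"] delta_B[OF that] that
    by (simp add: univ_B image_mono image_comp)
  ultimately show ?thesis by blast
qed

end

section \<open>Comparing dimension functions\<close>

text \<open>
  Equivalently, the dimension function of \<open>\<beta>\<close>, i.e. its minimum over supersets, is bounded by
  that of \<open>\<alpha>\<close>.
\<close>

definition dominated :: "'v set \<Rightarrow> ('v set \<Rightarrow> int) \<Rightarrow> ('v set \<Rightarrow> int) \<Rightarrow> bool" where
  "dominated V \<alpha> \<beta> \<longleftrightarrow> (\<forall>X\<subseteq>V. \<exists>Z. X \<subseteq> Z \<and> Z \<subseteq> V \<and> \<beta> Z \<le> \<alpha> X)"

lemma dominatedE:
  assumes "dominated V \<alpha> \<beta>" "X \<subseteq> V"
  obtains Z where "X \<subseteq> Z" "Z \<subseteq> V" "\<beta> Z \<le> \<alpha> X"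
proof -
  have "\<exists>Z. X \<subseteq> Z \<and> Z \<subseteq> V \<and> \<beta> Z \<le> \<alpha> X"
    using assms by (simp add: dominated_def)
  then show ?thesis
    by (elim exE conjE that)
qed

lemma dominated_top:
  assumes "dominated V \<alpha> \<beta>"
  shows "\<beta> V \<le> \<alpha> V"
proof -
  obtain Z where "V \<subseteq> Z" "Z \<subseteq> V" "\<beta> Z \<le> \<alpha> V"
    using assms order_refl by (rule dominatedE)
  then show ?thesis
    by (simp add: subset_antisym)
qed

lemma dominated_trans:
  assumes "dominated V \<alpha> \<beta>" "dominated V \<beta> \<gamma>"
  shows "dominated V \<alpha> \<gamma>"
  unfolding dominated_def
proof (intro allI impI)
  fix X assume X: "X \<subseteq> V"
  obtain Y where Y: "X \<subseteq> Y" "Y \<subseteq> V" "\<beta> Y \<le> \<alpha> X"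
    using assms(1) X by (rule dominatedE)
  obtain Z where "Y \<subseteq> Z" "Z \<subseteq> V" "\<gamma> Z \<le> \<beta> Y"
    using assms(2) Y(2) by (rule dominatedE)
  with Y show "\<exists>Z. X \<subseteq> Z \<and> Z \<subseteq> V \<and> \<gamma> Z \<le> \<alpha> X"
    by (intro exI[of _ Z]) auto
qed

lemma dominated_eqI:
  assumes "dominated V \<alpha> \<beta>"
    and "\<And>X. X \<subseteq> V \<Longrightarrow> \<alpha> X = \<alpha>' X" "\<And>X. X \<subseteq> V \<Longrightarrow> \<beta> X = \<beta>' X"
  shows "dominated V \<alpha>' \<beta>'"
  using assms unfolding dominated_def by (simp cong: conj_cong imp_cong)

lemma dominated_reindex:
  assumes "dominated A \<alpha> \<beta>" "bij_betw g W A"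
  shows "dominated W (\<lambda>X. \<alpha> (g ` X)) (\<lambda>X. \<beta> (g ` X))"
  unfolding dominated_def
proof (intro allI impI)
  fix X assume X: "X \<subseteq> W"
  have A: "A = g ` W"
    using assms(2) by (simp add: bij_betw_def)
  have gX: "g ` X \<subseteq> A"
    using X A by blast
  obtain Z where Z: "g ` X \<subseteq> Z" "Z \<subseteq> A" "\<beta> Z \<le> \<alpha> (g ` X)"
    using assms(1) gX by (rule dominatedE)
  let ?Z = "{w \<in> W. g w \<in> Z}"
  have "g ` ?Z = Z"
    using Z(2) A by auto
  then show "\<exists>Z. X \<subseteq> Z \<and> Z \<subseteq> W \<and> \<beta> (g ` Z) \<le> \<alpha> (g ` X)"
    using X Z by (intro exI[of _ ?Z]) auto
qed

text \<open>It suffices to enlarge \<open>X\<close> inside the base: this leaves the vertices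
  outside \<open>W\<close> unchanged and can only complete more edges.\<close>

lemma dominated_ext_delta:
  assumes "dominated W \<alpha> \<beta>" "W \<subseteq> V" "finite J"
  shows "dominated V (ext_delta W \<alpha> s J) (ext_delta W \<beta> s J)"
  unfolding dominated_def
proof (intro allI impI)
  fix X assume X: "X \<subseteq> V"
  obtain Z where Z: "X \<inter> W \<subseteq> Z" "Z \<subseteq> W" "\<beta> Z \<le> \<alpha> (X \<inter> W)"
    using assms(1) Int_lower2 by (rule dominatedE)
  have "(X \<union> Z) \<inter> W = Z" "X \<union> Z - W = X - W"
    using Z by auto
  moreover have "card {j \<in> J. s j \<subseteq> X} \<le> card {j \<in> J. s j \<subseteq> X \<union> Z}"
    using assms(3) by (intro card_mono) auto
  ultimately have "ext_delta W \<beta> s J (X \<union> Z) \<le> ext_delta W \<alpha> s J X"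
    using Z(3) by (simp add: ext_delta_def)
  then show "\<exists>Z. X \<subseteq> Z \<and> Z \<subseteq> V \<and> ext_delta W \<beta> s J Z \<le> ext_delta W \<alpha> s J X"
    using X Z assms(2) by (intro exI[of _ "X \<union> Z"]) auto
qed

text \<open>A maximal set among those no more expensive than \<open>X\<close> has absorbed
  everything that can be added at no cost. Different edge systems can then be compared on such sets
  only.\<close>

lemma exists_saturated_superset:
  fixes \<Phi> :: "'v set \<Rightarrow> int"
  assumes "finite V" "X \<subseteq> V"
  obtains Z where "X \<subseteq> Z" "Z \<subseteq> V" "\<Phi> Z \<le> \<Phi> X" "\<forall>D. D \<subseteq> V \<and> \<Phi> (Z \<union> D) \<le> \<Phi> Z \<longrightarrow> D \<subseteq> Z"
proof -
  let ?S = "{Z. X \<subseteq> Z \<and> Z \<subseteq> V \<and> \<Phi> Z \<le> \<Phi> X}"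
  have "finite ?S"
    using assms(1) by (intro finite_subset[of ?S "Pow V"]) auto
  moreover have "X \<in> ?S"
    using assms(2) by simp
  then have "?S \<noteq> {}"
    by (metis empty_iff)
  ultimately have "\<exists>Z\<in>?S. \<forall>b\<in>?S. Z \<subseteq> b \<longrightarrow> Z = b"
    by (intro finite_has_maximal)
  then obtain Z where Z: "Z \<in> ?S" "\<forall>b\<in>?S. Z \<subseteq> b \<longrightarrow> Z = b"
    by (elim bexE)
  have "D \<subseteq> Z" if "D \<subseteq> V" "\<Phi> (Z \<union> D) \<le> \<Phi> Z" for D
  proof -
    have "Z \<union> D \<in> ?S"
      using Z(1) that by (simp add: le_supI1)
    then have "Z = Z \<union> D"
      using bspec[OF Z(2), of "Z \<union> D"] by simp
    then show ?thesis by blast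
  qed
  then show ?thesis
    using Z(1) by (intro that[of Z]) simp_all
qed

text \<open>Every added vertex \<open>v\<close> is paid for by an edge of its own:
  \<open>\<tau> v\<close> contains \<open>v\<close>, so it was not yet inside \<open>Y\<close>. The
  base part is untouched because \<open>D\<close> avoids \<open>W\<close>.\<close>

lemma ext_delta_Un_le:
  assumes "finite Y" "finite D" "finite J" "D \<inter> W = {}"
    and \<tau>: "inj_on \<tau> (D - Y)"
      "\<And>v. v \<in> D - Y \<Longrightarrow> \<tau> v \<in> J \<and> v \<in> s (\<tau> v) \<and> s (\<tau> v) \<subseteq> Y \<union> D"
  shows "ext_delta W \<alpha> s J (Y \<union> D) \<le> ext_delta W \<alpha> s J Y"
proof -
  let ?J = "\<lambda>Y. {j \<in> J. s j \<subseteq> Y}"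
  have "?J Y \<inter> \<tau> ` (D - Y) = {}"
    using \<tau>(2) by blast
  then have "card (?J Y) + card (D - Y) = card (?J Y \<union> \<tau> ` (D - Y))"
    using assms(2,3) card_image[OF \<tau>(1)] by (subst card_Un_disjoint) auto
  also have "\<dots> \<le> card (?J (Y \<union> D))"
    using assms(3) \<tau>(2) by (intro card_mono) auto
  finally have "card (?J Y) + card (D - Y) \<le> card (?J (Y \<union> D))" .
  moreover have "Y \<union> D - W = (Y - W) \<union> (D - Y)" "(Y \<union> D) \<inter> W = Y \<inter> W"
    using assms(4) by auto
  moreover have "card ((Y - W) \<union> (D - Y)) = card (Y - W) + card (D - Y)"
    using assms(1,2) by (intro card_Un_disjoint) auto
  ultimately show ?thesis
    unfolding ext_delta_def by simp
qed

text \<open>Isolates the contribution of the base \<open>A\<close>, which can then be exchanged for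
  that of its copy in the other structure.\<close>

lemma delta_eq_ext_delta:
  assumes "nonneg_predim K N" "finite B" "B \<subseteq> univ N" "A \<subseteq> B" "Y \<subseteq> B"
  shows "delta K N Y
    = ext_delta A (delta K N) (\<lambda>j. supp K (snd j)) (edges K N B - edges K N A) Y"
proof -
  let ?J = "{j \<in> edges K N B - edges K N A. supp K (snd j) \<subseteq> Y}"
  have fin: "finite (edges K N B)"
    using assms(1-3) by (simp add: nonneg_predim_def)
  have "edges K N Y = edges K N (Y \<inter> A) \<union> ?J"
    using assms(5) by (auto simp: edges_def)
  moreover have "finite (edges K N (Y \<inter> A))"
    by (rule finite_subset[OF edges_mono fin]) (use assms(5) in auto)
  moreover have "edges K N (Y \<inter> A) \<inter> ?J = {}"
    by (auto simp: edges_def)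
  ultimately have "card (edges K N Y) = card (edges K N (Y \<inter> A)) + card ?J"
    using fin by (simp add: card_Un_disjoint)
  moreover have "card Y = card (Y \<inter> A) + card (Y - A)"
    using card_Int_Diff[of Y A] finite_subset[OF assms(5,2)] by simp
  ultimately show ?thesis
    unfolding delta_def ext_delta_def by simp
qed

text \<open>The conditions on the new predimension need no counting: each of its values is at least
  a value of \<Theta> on a superset. In the applications \<Theta> is a predimension in the other
  generic structure, where both bounds are known.\<close>

lemma (in kind_laws) generic_extend_dominated:
  fixes E :: "('v \<Rightarrow> 'a) \<Rightarrow> 'j \<Rightarrow> 'e" and N :: "('a, 'i, 'e) lstruct" and symb :: "'j \<Rightarrow> 'i"
  assumes gen: "generic K ar N"
    and V: "finite V" "W \<subseteq> V" and J: "finite J"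
    and g0: "inj_on g0 W" "closed_in K N (g0 ` W)"
    and sV: "\<And>j. j \<in> J \<Longrightarrow> s j \<subseteq> V" and sW: "\<And>j. j \<in> J \<Longrightarrow> \<not> s j \<subseteq> W"
    and E: "\<And>g j. inj_on g V \<Longrightarrow> j \<in> J \<Longrightarrow> legal K (ar (symb j)) (E g j) \<and> supp K (E g j) = g ` s j"
    and s_inj: "inj_on (\<lambda>j. (symb j, s j)) J"
    and dom: "dominated V (ext_delta W (\<lambda>X. delta K N (g0 ` X)) s J) \<Theta>"
    and nonneg: "\<And>Y. Y \<subseteq> V \<Longrightarrow> 0 \<le> \<Theta> Y"
    and minimal: "\<And>Y. W \<subseteq> Y \<Longrightarrow> Y \<subseteq> V \<Longrightarrow> delta K N (g0 ` W) \<le> \<Theta> Y"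
  shows "\<exists>h. inj_on h V \<and> (\<forall>x\<in>W. h x = g0 x) \<and> closed_in K N (h ` V) \<and>
    (\<forall>Y\<subseteq>V. delta K N (h ` Y) = ext_delta W (\<lambda>X. delta K N (g0 ` X)) s J Y)"
proof (rule generic_extend[where E = E and symb = symb, OF gen V J g0 sV sW E s_inj])
  let ?\<Delta> = "ext_delta W (\<lambda>X. delta K N (g0 ` X)) s J"
  fix Y assume Y: "Y \<subseteq> V"
  obtain Z where Z: "Y \<subseteq> Z" "Z \<subseteq> V" "\<Theta> Z \<le> ?\<Delta> Y"
    using dom Y by (rule dominatedE)
  show "0 \<le> ?\<Delta> Y"
    using nonneg[OF Z(2)] Z(3) by simp
  show "delta K N (g0 ` W) \<le> ?\<Delta> Y" if "W \<subseteq> Y"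
    using minimal[OF order_trans[OF that Z(1)] Z(2)] Z(3) by simp
qed

section \<open>The gadget replacing a tuple by sets\<close>

text \<open>
  Each \<open>e \<in> T\<close> stands for a tuple of arity \<open>n e\<close> with support \<open>S e\<close>, not contained in the base
  \<open>W\<close>. It receives fresh vertices \<open>Inr (e, k)\<close>: those with \<open>k \<le> n e\<close> have dimension 0, and
  \<open>Inr (e, n e + 1)\<close> is parallel to \<open>c e \<in> S e\<close>. The edges \<open>tuple_supp\<close> achieve this with
  tuples with repetitions, and keep the edge \<open>S e\<close> as number \<open>n e + 2\<close>. The edges \<open>set_supp\<close>
  have exactly \<open>n e\<close> elements: in the last one the parallel element replaces \<open>c e\<close>, so that
  it differs from \<open>S e\<close> even if \<open>S e\<close> has \<open>n e\<close> elements and supports several tuples.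
\<close>

locale gadget =
  fixes T :: "'t set" and n :: "'t \<Rightarrow> nat" and S :: "'t \<Rightarrow> 'b set" and c :: "'t \<Rightarrow> 'b"
    and B W :: "'b set"
  assumes finite_T: "finite T" and finite_B: "finite B" and W_B: "W \<subseteq> B"
    and S_B: "e \<in> T \<Longrightarrow> S e \<subseteq> B" and c_S: "e \<in> T \<Longrightarrow> c e \<in> S e"
    and c_W: "e \<in> T \<Longrightarrow> c e \<notin> W" and card_S: "e \<in> T \<Longrightarrow> card (S e) \<le> n e"
    and n_ge: "e \<in> T \<Longrightarrow> 3 \<le> n e"
begin

definition new_edges :: "('t \<times> nat) set" where
  "new_edges = (SIGMA e:T. {..Suc (n e)})"

definition all_edges :: "('t \<times> nat) set" where
  "all_edges = (SIGMA e:T. {..Suc (Suc (n e))})"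

definition verts :: "('b + 't \<times> nat) set" where
  "verts = Inl ` B \<union> Inr ` new_edges"

definition tuple_supp :: "'t \<times> nat \<Rightarrow> ('b + 't \<times> nat) set" where
  "tuple_supp = (\<lambda>(e, k).
    if k \<le> n e then {Inr (e, k)}
    else if k = Suc (n e) then {Inr (e, k), Inl (c e)}
    else Inl ` S e)"

text \<open>Edge \<open>k \<le> n e\<close> omits vertex \<open>k\<close> from the
  \<open>n e + 1\<close> padding vertices. The other two kinds are filled up with padding to
  \<open>n e\<close> elements: \<open>n e - 2\<close> besides a parallel pair, and
  \<open>n e - card (S e)\<close> besides the support, whose size is unchanged by the exchange of
  \<open>c e\<close>.\<close>

definition set_supp :: "'t \<times> nat \<Rightarrow> ('b + 't \<times> nat) set" where
  "set_supp = (\<lambda>(e, k).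
    if k \<le> n e then Inr ` ({e} \<times> ({..n e} - {k}))
    else if k = Suc (n e) then {Inr (e, k), Inl (c e)} \<union> Inr ` ({e} \<times> {..<n e - 2})
    else Inl ` (S e - {c e}) \<union> {Inr (e, Suc (n e))} \<union> Inr ` ({e} \<times> {..<n e - card (S e)}))"

section \<open>Well-formedness of the gadget\<close>

lemma finite_S: "e \<in> T \<Longrightarrow> finite (S e)"
  using S_B finite_B finite_subset by blast

lemma c_B: "e \<in> T \<Longrightarrow> c e \<in> B"
  using S_B c_S by (meson subsetD)

lemma finite_all_edges: "finite all_edges"
  using finite_T by (simp add: all_edges_def)

lemma new_edges_all_edges: "new_edges \<subseteq> all_edges"
  by (auto simp: new_edges_def all_edges_def)

lemma finite_new_edges: "finite new_edges"
  using new_edges_all_edges finite_all_edges by (rule finite_subset)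

lemma finite_verts: "finite verts"
  using finite_B finite_new_edges by (simp add: verts_def)

lemma edge_cases:
  assumes "j \<in> all_edges"
  obtains e k where "j = (e, k)" "e \<in> T" "k \<le> n e"
  | e where "j = (e, Suc (n e))" "e \<in> T"
  | e where "j = (e, Suc (Suc (n e)))" "e \<in> T"
proof -
  obtain e k where j: "j = (e, k)" "e \<in> T" "k \<le> Suc (Suc (n e))"
    using assms by (auto simp: all_edges_def)
  then consider "k \<le> n e" | "k = Suc (n e)" | "k = Suc (Suc (n e))"
    by linarith
  then show ?thesis
    using j that by cases auto
qed

lemma tuple_supp_simps:
  "k \<le> n e \<Longrightarrow> tuple_supp (e, k) = {Inr (e, k)}"
  "tuple_supp (e, Suc (n e)) = {Inr (e, Suc (n e)), Inl (c e)}"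
  "tuple_supp (e, Suc (Suc (n e))) = Inl ` S e"
  by (auto simp: tuple_supp_def)

lemma set_supp_simps:
  "k \<le> n e \<Longrightarrow> set_supp (e, k) = Inr ` ({e} \<times> ({..n e} - {k}))"
  "set_supp (e, Suc (n e)) = {Inr (e, Suc (n e)), Inl (c e)} \<union> Inr ` ({e} \<times> {..<n e - 2})"
  "set_supp (e, Suc (Suc (n e)))
    = Inl ` (S e - {c e}) \<union> {Inr (e, Suc (n e))} \<union> Inr ` ({e} \<times> {..<n e - card (S e)})"
  by (auto simp: set_supp_def)

lemma Inr_verts: "Inr (e, k) \<in> verts \<longleftrightarrow> e \<in> T \<and> k \<le> Suc (n e)"
  by (auto simp: verts_def new_edges_def)

lemma Inl_verts: "Inl b \<in> verts \<longleftrightarrow> b \<in> B"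
  by (auto simp: verts_def)

lemma tuple_supp_verts: "j \<in> new_edges \<Longrightarrow> tuple_supp j \<subseteq> verts"
  using c_B by (auto simp: tuple_supp_def Inr_verts Inl_verts new_edges_def split: if_splits)

lemma set_supp_verts:
  assumes "j \<in> all_edges"
  shows "set_supp j \<subseteq> verts"
  using assms
  by (cases rule: edge_cases)
    (use subsetD[OF S_B] c_B n_ge in \<open>auto simp: set_supp_simps Inr_verts Inl_verts\<close>)

lemma set_supp_fresh:
  assumes "j \<in> all_edges"
  shows "\<not> set_supp j \<subseteq> range Inl"
  using assms
proof (cases rule: edge_cases)
  case (1 e k)
  \<comment> \<open>Edge \<open>k\<close> omits only the padding vertex \<open>k\<close>, so vertex
    0 is a witness unless \<open>k\<close> is 0.\<close>
  then have "Inr (e, if k = 0 then 1 else 0) \<in> set_supp j"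
    using n_ge by (force simp: set_supp_simps)
  then show ?thesis by auto
qed (auto simp: set_supp_simps)

lemma card_set_supp:
  assumes "(e, k) \<in> all_edges"
  shows "finite (set_supp (e, k)) \<and> card (set_supp (e, k)) = n e"
proof -
  have card_Inr: "card (Inr ` ({e} \<times> X) :: ('b + 't \<times> nat) set) = card X" for e X
    by (subst card_image) (auto simp: inj_on_def card_cartesian_product_singleton)
  from assms show ?thesis
  proof (cases rule: edge_cases)
    case (1 e' k')
    then have "set_supp (e, k) = Inr ` ({e} \<times> ({..n e} - {k}))" "k \<le> n e"
      by (auto simp: set_supp_simps)
    then show ?thesis
      by (simp add: card_Inr)
  next
    case (2 e')
    then show ?thesis
      using n_ge[of e] by (simp add: set_supp_simps card_Inr card_insert_if image_iff)
  next
    case (3 e')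
    then have e: "k = Suc (Suc (n e))" "e \<in> T" by auto
    have "card (Inl ` (S e - {c e}) :: ('b + 't \<times> nat) set) = card (S e) - 1"
      using e c_S by (simp add: card_image)
    moreover have "0 < card (S e)"
      using e c_S finite_S by (auto simp: card_gt_0_iff)
    moreover have "card (set_supp (e, Suc (Suc (n e))))
        = card (Inl ` (S e - {c e}) \<union> {Inr (e, Suc (n e))} :: ('b + 't \<times> nat) set) + (n e - card (S e))"
      unfolding set_supp_simps using e finite_S card_Inr by (subst card_Un_disjoint) auto
    moreover have "card (Inl ` (S e - {c e}) \<union> {Inr (e, Suc (n e))} :: ('b + 't \<times> nat) set)
        = card (Inl ` (S e - {c e}) :: ('b + 't \<times> nat) set) + 1"
      using e finite_S by (subst card_Un_disjoint) auto
    moreover have "finite (set_supp (e, Suc (Suc (n e))))"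
      unfolding set_supp_simps using e finite_S by simp
    ultimately show ?thesis
      using card_S[OF e(2)] e(1) by simp
  qed
qed

text \<open>An edge can be decoded. Any fresh vertex reveals \<open>e\<close>; the parallel vertex
  occurs exactly when \<open>k > n e\<close>; below that, \<open>k\<close> is the omitted padding
  vertex; and \<open>Inl (c e)\<close> tells the last two edges apart.\<close>

lemma inj_on_set_supp: "inj_on set_supp all_edges"
proof (rule inj_onI)
  fix j j' assume j: "j \<in> all_edges" "j' \<in> all_edges" and eq: "set_supp j = set_supp j'"
  have code: "Inr (e', l) \<in> set_supp (e, k) \<Longrightarrow> e' = e" for e e' k l
    by (auto simp: set_supp_def split: if_splits)
  have top: "Inr (e, Suc (n e)) \<in> set_supp (e, k) \<longleftrightarrow> \<not> k \<le> n e" for e k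
    by (auto simp: set_supp_def)
  obtain e k e' k' where jk: "j = (e, k)" "j' = (e', k')"
    by (metis surj_pair)
  obtain x where "x \<in> set_supp j" "x \<notin> range Inl"
    using set_supp_fresh[OF j(1)] by blast
  then obtain e0 l where "Inr (e0, l) \<in> set_supp j"
    by (cases x) auto
  then have e: "e' = e"
    using eq code unfolding jk by blast
  have "k \<le> n e \<longleftrightarrow> k' \<le> n e"
    using eq top[of e k] top[of e k'] unfolding jk e by blast
  have ke: "e \<in> T" "k \<le> Suc (Suc (n e))" "k' \<le> Suc (Suc (n e))"
    using j unfolding jk e by (auto simp: all_edges_def)
  have "k = k'"
  proof (cases "k \<le> n e")
    case True
    then have "k' \<le> n e"
      using \<open>k \<le> n e \<longleftrightarrow> k' \<le> n e\<close> by simp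
    have "Inr (e, k) \<notin> set_supp j"
      using True unfolding jk by (auto simp: set_supp_simps)
    then have "Inr (e, k) \<notin> set_supp (e, k')"
      using eq unfolding jk e by simp
    then show ?thesis
      using True \<open>k' \<le> n e\<close> by (auto simp: set_supp_simps)
  next
    case False
    have c: "Inl (c e) \<in> set_supp (e, l) \<longleftrightarrow> l = Suc (n e)" if "n e < l" for l
      using that by (auto simp: set_supp_def)
    have "k = Suc (n e) \<longleftrightarrow> k' = Suc (n e)"
      using eq c[of k] c[of k'] False \<open>k \<le> n e \<longleftrightarrow> k' \<le> n e\<close> unfolding jk e by simp
    then show ?thesis
      using False ke \<open>k \<le> n e \<longleftrightarrow> k' \<le> n e\<close> by linarith
  qed
  then show "j = j'"
    by (simp add: jk e)
qed

text \<open>Once all padding is present it imposes no condition, and exchanging \<open>c e\<close>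
  for its parallel vertex makes no difference to a set that contains both or neither.\<close>

lemma supp_subset_iff:
  assumes j: "j \<in> all_edges"
    and loops: "\<And>e k. e \<in> T \<Longrightarrow> k \<le> n e \<Longrightarrow> Inr (e, k) \<in> Z"
    and parallel: "\<And>e. e \<in> T \<Longrightarrow> Inr (e, Suc (n e)) \<in> Z \<longleftrightarrow> Inl (c e) \<in> Z"
  shows "tuple_supp j \<subseteq> Z \<longleftrightarrow> set_supp j \<subseteq> Z"
  using j
proof (cases rule: edge_cases)
  case (1 e k)
  then show ?thesis
    using loops by (auto simp: set_supp_simps tuple_supp_simps)
next
  case (2 e)
  then show ?thesis
    using loops by (auto simp: set_supp_simps tuple_supp_simps)
next
  case (3 e)
  have "Inl ` S e \<subseteq> Z \<longleftrightarrow> Inl ` (S e - {c e}) \<subseteq> Z \<and> Inr (e, Suc (n e)) \<in> Z"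
    using c_S[OF 3(2)] parallel[OF 3(2)] by auto
  moreover have "Inr ` ({e} \<times> {..<n e - card (S e)}) \<subseteq> Z"
    using loops[OF 3(2)] by auto
  ultimately show ?thesis
    unfolding 3(1) set_supp_simps tuple_supp_simps by (simp add: conj_commute)
qed

text \<open>A single vertex that completes an edge is paid for by this edge, so a saturated set
  already contains it.\<close>

lemma saturated_insert:
  assumes sat: "\<forall>D. D \<subseteq> verts \<and> ext_delta (Inl ` W) \<alpha> s all_edges (Z \<union> D)
      \<le> ext_delta (Inl ` W) \<alpha> s all_edges Z \<longrightarrow> D \<subseteq> Z"
    and Z: "Z \<subseteq> verts" and v: "v \<in> verts" "v \<notin> Inl ` W"
    and j: "j \<in> all_edges" "v \<in> s j" "s j \<subseteq> insert v Z"
  shows "v \<in> Z"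
proof -
  have "finite Z"
    using Z finite_verts finite_subset by blast
  then have "ext_delta (Inl ` W) \<alpha> s all_edges (Z \<union> {v}) \<le> ext_delta (Inl ` W) \<alpha> s all_edges Z"
    using v j finite_all_edges
    by (intro ext_delta_Un_le[where \<tau> = "\<lambda>_. j"]) (auto simp: inj_on_def)
  then show ?thesis
    using sat v(1) by blast
qed

text \<open>In a saturated set the edges force the hypotheses of \<open>supp_subset_iff\<close>, so
  there both edge systems have the same predimension.\<close>

lemma dominated_tuple_set:
  "dominated verts (ext_delta (Inl ` W) \<alpha> tuple_supp all_edges) (ext_delta (Inl ` W) \<alpha> set_supp all_edges)"
  unfolding dominated_def
proof (intro allI impI)
  let ?\<Phi> = "ext_delta (Inl ` W) \<alpha> tuple_supp all_edges"
  fix X assume "X \<subseteq> verts"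
  then obtain Z where Z: "X \<subseteq> Z" "Z \<subseteq> verts" "?\<Phi> Z \<le> ?\<Phi> X"
    and sat: "\<forall>D. D \<subseteq> verts \<and> ?\<Phi> (Z \<union> D) \<le> ?\<Phi> Z \<longrightarrow> D \<subseteq> Z"
    by (rule exists_saturated_superset[OF finite_verts])
  note insert = saturated_insert[OF sat Z(2)]
  have loops: "Inr (e, k) \<in> Z" if "e \<in> T" "k \<le> n e" for e k
    using that by (intro insert[of _ "(e, k)"]) (auto simp: Inr_verts all_edges_def tuple_supp_simps)
  \<comment> \<open>Either end of the pair completes the edge once the other is present. For
    \<open>c e\<close> this uses that it lies outside the base, where adding a vertex costs at most
    1.\<close>
  have parallel: "Inr (e, Suc (n e)) \<in> Z \<longleftrightarrow> Inl (c e) \<in> Z" if "e \<in> T" for e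
  proof
    assume "Inr (e, Suc (n e)) \<in> Z"
    then show "Inl (c e) \<in> Z"
      using that c_B c_W
      by (intro insert[of _ "(e, Suc (n e))"])
        (auto simp: Inl_verts all_edges_def tuple_supp_def)
  next
    assume "Inl (c e) \<in> Z"
    then show "Inr (e, Suc (n e)) \<in> Z"
      using that
      by (intro insert[of _ "(e, Suc (n e))"])
        (auto simp: Inr_verts all_edges_def tuple_supp_def)
  qed
  have "{j \<in> all_edges. tuple_supp j \<subseteq> Z} = {j \<in> all_edges. set_supp j \<subseteq> Z}"
    using supp_subset_iff[OF _ loops parallel] by blast
  then have "ext_delta (Inl ` W) \<alpha> set_supp all_edges Z = ?\<Phi> Z"
    by (simp add: ext_delta_def)
  with Z show "\<exists>Z. X \<subseteq> Z \<and> Z \<subseteq> verts \<and> ext_delta (Inl ` W) \<alpha> set_supp all_edges Z \<le> ?\<Phi> X"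
    by (intro exI[of _ Z]) simp
qed

lemma dominated_set_tuple:
  "dominated verts (ext_delta (Inl ` W) \<alpha> set_supp all_edges) (ext_delta (Inl ` W) \<alpha> tuple_supp all_edges)"
  unfolding dominated_def
proof (intro allI impI)
  let ?\<Phi> = "ext_delta (Inl ` W) \<alpha> set_supp all_edges"
  fix X assume "X \<subseteq> verts"
  then obtain Z where Z: "X \<subseteq> Z" "Z \<subseteq> verts" "?\<Phi> Z \<le> ?\<Phi> X"
    and sat: "\<forall>D. D \<subseteq> verts \<and> ?\<Phi> (Z \<union> D) \<le> ?\<Phi> Z \<longrightarrow> D \<subseteq> Z"
    by (rule exists_saturated_superset[OF finite_verts])
  have finZ: "finite Z"
    using Z(2) finite_verts finite_subset by blast
  note insert = saturated_insert[OF sat Z(2)]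
  \<comment> \<open>Padding vertices added one at a time may raise the predimension at first, so all
    missing ones are added together.\<close>
  have loops: "Inr (e, k) \<in> Z" if e: "e \<in> T" and "k \<le> n e" for e k
  proof -
    let ?D = "Inr ` ({e} \<times> {..n e}) :: ('b + 't \<times> nat) set"
    \<comment> \<open>The cyclic successor gives each vertex its own edge: edge
      \<open>?next k\<close> omits only vertex \<open>?next k\<close>, hence contains vertex
      \<open>k\<close>.\<close>
    let ?next = "\<lambda>k. if k = n e then 0 else Suc k"
    let ?\<tau> = "\<lambda>v. (e, ?next (snd (projr v)))"
    have "?\<Phi> (Z \<union> ?D) \<le> ?\<Phi> Z"
    proof (rule ext_delta_Un_le[where \<tau> = ?\<tau>, OF finZ _ finite_all_edges])
      show "inj_on ?\<tau> (?D - Z)"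
        by (auto simp: inj_on_def split: if_splits)
    next
      fix v assume "v \<in> ?D - Z"
      then obtain k where k: "v = Inr (e, k)" "k \<le> n e"
        by auto
      then have next_k: "?next k \<le> n e" "?next k \<noteq> k"
        using n_ge[OF e] by auto
      then have "set_supp (?\<tau> v) = Inr ` ({e} \<times> ({..n e} - {?next k}))"
        using set_supp_simps(1)[OF next_k(1)] by (simp only: k(1) sum.sel snd_conv)
      moreover have "?\<tau> v \<in> all_edges"
        using next_k e by (auto simp: k(1) all_edges_def)
      ultimately show "?\<tau> v \<in> all_edges \<and> v \<in> set_supp (?\<tau> v) \<and> set_supp (?\<tau> v) \<subseteq> Z \<union> ?D"
        using k next_k by auto
    qed auto
    moreover have "?D \<subseteq> verts"
      using e by (auto simp: Inr_verts)
    ultimately have "?D \<subseteq> Z"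
      using sat by blast
    then show ?thesis
      using that by auto
  qed
  have parallel: "Inr (e, Suc (n e)) \<in> Z \<longleftrightarrow> Inl (c e) \<in> Z" if e: "e \<in> T" for e
  proof
    assume "Inr (e, Suc (n e)) \<in> Z"
    then show "Inl (c e) \<in> Z"
      using e c_B c_W loops[OF e]
      by (intro insert[of _ "(e, Suc (n e))"])
        (auto simp: Inl_verts all_edges_def set_supp_def)
  next
    assume "Inl (c e) \<in> Z"
    then show "Inr (e, Suc (n e)) \<in> Z"
      using e loops[OF e]
      by (intro insert[of _ "(e, Suc (n e))"])
        (auto simp: Inr_verts all_edges_def set_supp_def)
  qed
  have "{j \<in> all_edges. tuple_supp j \<subseteq> Z} = {j \<in> all_edges. set_supp j \<subseteq> Z}"
    using supp_subset_iff[OF _ loops parallel] by blast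
  then have "ext_delta (Inl ` W) \<alpha> tuple_supp all_edges Z = ?\<Phi> Z"
    by (simp add: ext_delta_def)
  with Z show "\<exists>Z. X \<subseteq> Z \<and> Z \<subseteq> verts \<and> ext_delta (Inl ` W) \<alpha> tuple_supp all_edges Z \<le> ?\<Phi> X"
    by (intro exI[of _ Z]) simp
qed

text \<open>The enlargement is realised over \<open>B\<close>, but the comparison with sets takes
  place over \<open>W\<close>. The edges of \<open>B\<close> outside \<open>W\<close> reappear in
  the latter description with number \<open>n e + 2\<close>.\<close>

lemma ext_delta_stages:
  assumes \<gamma>: "\<And>X. X \<subseteq> B \<Longrightarrow> \<gamma> X = ext_delta W \<beta> S T X" and Y: "Y \<subseteq> verts"
  shows "ext_delta (Inl ` B) (\<lambda>X. \<gamma> (projl ` X)) tuple_supp new_edges Y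
    = ext_delta (Inl ` W) (\<lambda>X. \<beta> (projl ` X)) tuple_supp all_edges Y"
proof -
  let ?Y = "projl ` (Y \<inter> Inl ` B)"
  have mem_Y: "b \<in> ?Y \<longleftrightarrow> b \<in> B \<and> Inl b \<in> Y" for b
    by force
  have YW: "?Y \<inter> W = projl ` (Y \<inter> Inl ` W)"
    using W_B by force
  have finY: "finite Y"
    using Y finite_verts finite_subset by blast
  have "card (Y - Inl ` W) = card (Y - Inl ` B) + card (?Y - W)"
  proof -
    have "Y - Inl ` W = (Y - Inl ` B) \<union> Inl ` (?Y - W)"
      using W_B by (auto simp: mem_Y)
    moreover have "card ((Y - Inl ` B) \<union> Inl ` (?Y - W))
        = card (Y - Inl ` B) + card (Inl ` (?Y - W) :: ('b + 't \<times> nat) set)"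
      using finY by (intro card_Un_disjoint) (auto simp: mem_Y)
    ultimately show ?thesis
      by (simp add: card_image)
  qed
  moreover have "card {j \<in> all_edges. tuple_supp j \<subseteq> Y}
      = card {j \<in> new_edges. tuple_supp j \<subseteq> Y} + card {e \<in> T. S e \<subseteq> ?Y}"
  proof -
    have S_Y: "S e \<subseteq> ?Y \<longleftrightarrow> Inl ` S e \<subseteq> Y" if "e \<in> T" for e
      using S_B[OF that] by (auto simp: subset_iff mem_Y)
    have "{j \<in> all_edges. tuple_supp j \<subseteq> Y}
        = {j \<in> new_edges. tuple_supp j \<subseteq> Y} \<union> (\<lambda>e. (e, Suc (Suc (n e)))) ` {e \<in> T. S e \<subseteq> ?Y}"
      (is "?L = ?R")
    proof (intro equalityI subsetI)
      fix j assume "j \<in> ?L"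
      then have "j \<in> all_edges" "tuple_supp j \<subseteq> Y" by auto
      then show "j \<in> ?R"
      proof (cases rule: edge_cases)
        case (3 e)
        then have "S e \<subseteq> ?Y"
          using \<open>tuple_supp j \<subseteq> Y\<close> unfolding S_Y[OF 3(2)] 3(1) tuple_supp_simps by simp
        then show ?thesis
          using 3 by blast
      qed (auto simp: new_edges_def)
    next
      fix j assume "j \<in> ?R"
      then show "j \<in> ?L"
      proof
        assume "j \<in> {j \<in> new_edges. tuple_supp j \<subseteq> Y}"
        then show ?thesis
          using new_edges_all_edges by blast
      next
        assume "j \<in> (\<lambda>e. (e, Suc (Suc (n e)))) ` {e \<in> T. S e \<subseteq> ?Y}"
        then obtain e where "e \<in> T" "S e \<subseteq> ?Y" "j = (e, Suc (Suc (n e)))"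
          by blast
        then show ?thesis
          using S_Y by (simp add: tuple_supp_simps all_edges_def)
      qed
    qed
    moreover have "card ({j \<in> new_edges. tuple_supp j \<subseteq> Y} \<union> (\<lambda>e. (e, Suc (Suc (n e)))) ` {e \<in> T. S e \<subseteq> ?Y})
        = card {j \<in> new_edges. tuple_supp j \<subseteq> Y} + card ((\<lambda>e. (e, Suc (Suc (n e)))) ` {e \<in> T. S e \<subseteq> ?Y})"
      using finite_new_edges finite_T by (intro card_Un_disjoint) (auto simp: new_edges_def)
    moreover have "card ((\<lambda>e. (e, Suc (Suc (n e)))) ` {e \<in> T. S e \<subseteq> ?Y}) = card {e \<in> T. S e \<subseteq> ?Y}"
      by (intro card_image) (auto simp: inj_on_def)
    ultimately show ?thesis by simp
  qed
  moreover have "\<gamma> ?Y = ext_delta W \<beta> S T ?Y"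
    by (intro \<gamma>) auto
  ultimately show ?thesis
    by (simp add: ext_delta_def YW)
qed

end

section \<open>Back and forth\<close>

text \<open>The dimensions are compared inside \<open>A\<close> and its image only. Self-sufficiency
  makes them the dimensions in the whole structures, as \<open>partial_iso_dim\<close>
  shows.\<close>

definition partial_iso ::
  "('a, 'e) kind \<Rightarrow> ('a, 'i, 'e) lstruct \<Rightarrow> ('b, 'f) kind \<Rightarrow> ('b, 'j, 'f) lstruct
    \<Rightarrow> 'a set \<Rightarrow> ('a \<Rightarrow> 'b) \<Rightarrow> bool" where
  "partial_iso K M L N A f \<longleftrightarrow>
    closed_in K M A \<and> inj_on f A \<and> closed_in L N (f ` A) \<and>
    dominated A (delta K M) (\<lambda>X. delta L N (f ` X)) \<and>
    dominated A (\<lambda>X. delta L N (f ` X)) (delta K M)"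

lemma partial_iso_forth:
  fixes M :: "('a::infinite, 'i, 'a set) lstruct" and N :: "('b::infinite, 'i, 'b list) lstruct"
  assumes genM: "generic subsets_kind ar M" and genN: "generic tuples_kind ar N"
    and iso: "partial_iso subsets_kind M tuples_kind N A f"
    and a: "a \<in> univ M"
  shows "\<exists>A' f'. partial_iso subsets_kind M tuples_kind N A' f' \<and> A \<subseteq> A' \<and> (\<forall>x\<in>A. f' x = f x) \<and>
    a \<in> A'"
proof -
  let ?K = "subsets_kind :: ('a, 'a set) kind" and ?L = "tuples_kind :: ('b, 'b list) kind"
  have A: "closed_in ?K M A" and f: "inj_on f A" "closed_in ?L N (f ` A)"
    and dom: "dominated A (delta ?K M) (\<lambda>X. delta ?L N (f ` X))"
      "dominated A (\<lambda>X. delta ?L N (f ` X)) (delta ?K M)"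
    using iso by (simp_all add: partial_iso_def)
  have nn: "nonneg_predim ?K M"
    using genM by (rule generic_nonneg_predim)
  have "finite (insert a A)" "insert a A \<subseteq> univ M"
    using A a by (simp_all add: closed_in_def)
  then obtain B where aB: "insert a A \<subseteq> B" and B: "closed_in ?K M B"
    by (rule exists_closed_in_superset[OF nn])
  have AB: "A \<subseteq> B" and finB: "finite B" and BM: "B \<subseteq> univ M"
    using aB B by (simp_all add: closed_in_def)
  let ?J = "edges ?K M B - edges ?K M A"
  let ?s = "\<lambda>j :: 'i \<times> 'a set. supp ?K (snd j)"
  have finJ: "finite ?J"
    using nn finB BM by (simp add: nonneg_predim_def)
  have delta_M: "delta ?K M Y = ext_delta A (delta ?K M) ?s ?J Y" if "Y \<subseteq> B" for Y
    by (rule delta_eq_ext_delta[OF nn finB BM AB that])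
  have J: "finite e \<and> card e = ar i \<and> e \<subseteq> B \<and> \<not> e \<subseteq> A" if "(i, e) \<in> ?J" for i e
  proof -
    have "e \<in> rels M i"
      using that by (simp add: mem_edges)
    then have "legal ?K (ar i) e"
      using genM by (simp add: generic_def is_lstruct_def)
    then show ?thesis
      using that by (simp add: mem_edges subsets_kind_def)
  qed
  \<comment> \<open>Any listing without repetitions will do: its length is the cardinality, hence
    the arity.\<close>
  define enum :: "'a set \<Rightarrow> 'a list" where "enum e = (SOME xs. set xs = e \<and> distinct xs)" for e
  have enum: "set (enum e) = e \<and> length (enum e) = card e" if "finite e" for e
  proof -
    have "set (enum e) = e \<and> distinct (enum e)"
      unfolding enum_def using finite_distinct_list[OF that] by (rule someI_ex)
    then show ?thesis
      by (metis distinct_card)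
  qed
  have "dominated B (ext_delta A (\<lambda>X. delta ?L N (f ` X)) ?s ?J) (ext_delta A (delta ?K M) ?s ?J)"
    by (rule dominated_ext_delta[OF dom(2) AB finJ])
  then have dom_NM: "dominated B (ext_delta A (\<lambda>X. delta ?L N (f ` X)) ?s ?J) (delta ?K M)"
    by (rule dominated_eqI[OF _ refl delta_M[symmetric]])
  have "dominated B (ext_delta A (delta ?K M) ?s ?J) (ext_delta A (\<lambda>X. delta ?L N (f ` X)) ?s ?J)"
    by (rule dominated_ext_delta[OF dom(1) AB finJ])
  then have dom_MN: "dominated B (delta ?K M) (ext_delta A (\<lambda>X. delta ?L N (f ` X)) ?s ?J)"
    by (rule dominated_eqI[OF _ delta_M[symmetric] refl])
  have "\<exists>h. inj_on h B \<and> (\<forall>x\<in>A. h x = f x) \<and> closed_in ?L N (h ` B) \<and>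
    (\<forall>Y\<subseteq>B. delta ?L N (h ` Y) = ext_delta A (\<lambda>X. delta ?L N (f ` X)) ?s ?J Y)"
  proof (rule tuples.generic_extend_dominated[where symb = fst and E = "\<lambda>g (i, e). map g (enum e)",
        OF genN finB AB finJ f _ _ _ _ dom_NM])
    show "?s j \<subseteq> B" "\<not> ?s j \<subseteq> A" if "j \<in> ?J" for j
      using J[of "fst j" "snd j"] that by (simp_all add: subsets_kind_def case_prod_beta)
    show "legal ?L (ar (fst j)) (case j of (i, e) \<Rightarrow> map g (enum e)) \<and>
        supp ?L (case j of (i, e) \<Rightarrow> map g (enum e)) = g ` ?s j"
      if "inj_on g B" "j \<in> ?J" for g :: "'a \<Rightarrow> 'b" and j
      using J[of "fst j" "snd j"] that(2) enum
      by (simp add: subsets_kind_def tuples_kind_def case_prod_beta)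
    show "inj_on (\<lambda>j. (fst j, ?s j)) ?J"
      by (auto simp: inj_on_def subsets_kind_def)
    show "0 \<le> delta ?K M Y" if "Y \<subseteq> B" for Y
      using nn that finite_subset[OF that finB] BM by (simp add: nonneg_predim_def)
    show "delta ?L N (f ` A) \<le> delta ?K M Y" if "A \<subseteq> Y" "Y \<subseteq> B" for Y
    proof -
      have "delta ?L N (f ` A) \<le> delta ?K M A"
        using dominated_top[OF dom(1)] .
      also have "\<dots> \<le> delta ?K M Y"
        using A that finite_subset[OF that(2) finB] BM by (simp add: closed_in_def)
      finally show ?thesis .
    qed
  qed
  then obtain h where h: "inj_on h B" "\<forall>x\<in>A. h x = f x" "closed_in ?L N (h ` B)"
    and delta_h: "\<forall>Y\<subseteq>B. delta ?L N (h ` Y) = ext_delta A (\<lambda>X. delta ?L N (f ` X)) ?s ?J Y"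
    by (elim exE conjE)
  have "dominated B (delta ?K M) (\<lambda>X. delta ?L N (h ` X))"
    "dominated B (\<lambda>X. delta ?L N (h ` X)) (delta ?K M)"
    by (rule dominated_eqI[OF dom_MN] dominated_eqI[OF dom_NM]; simp add: delta_h)+
  then have "partial_iso ?K M ?L N B h"
    using B h by (simp add: partial_iso_def)
  then show ?thesis
    using aB AB h(2) by (intro exI[of _ B] exI[of _ h]) simp
qed

text \<open>Both structures receive a copy of the same vertex set \<open>verts\<close>:
  \<open>h\<close> places it in \<open>N\<close> over \<open>B\<close>, and \<open>h'\<close> places
  it in \<open>M\<close> over \<open>A\<close>. The new map is \<open>h\<close> after the inverse of
  \<open>h'\<close>.\<close>

lemma partial_iso_back:
  fixes M :: "('a::infinite, 'i, 'a set) lstruct" and N :: "('b::infinite, 'i, 'b list) lstruct"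
  assumes ar: "\<And>i. 3 \<le> ar i"
    and genM: "generic subsets_kind ar M" and genN: "generic tuples_kind ar N"
    and iso: "partial_iso subsets_kind M tuples_kind N A f"
    and b: "b \<in> univ N"
  shows "\<exists>A' f'. partial_iso subsets_kind M tuples_kind N A' f' \<and> A \<subseteq> A' \<and> (\<forall>x\<in>A. f' x = f x) \<and>
    b \<in> f' ` A'"
proof -
  let ?K = "subsets_kind :: ('a, 'a set) kind" and ?L = "tuples_kind :: ('b, 'b list) kind"
  have A: "closed_in ?K M A" and f: "inj_on f A" "closed_in ?L N (f ` A)"
    and dom: "dominated A (delta ?K M) (\<lambda>X. delta ?L N (f ` X))"
      "dominated A (\<lambda>X. delta ?L N (f ` X)) (delta ?K M)"
    using iso by (simp_all add: partial_iso_def)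
  have nn: "nonneg_predim ?L N"
    using genN by (rule generic_nonneg_predim)
  have "finite (insert b (f ` A))" "insert b (f ` A) \<subseteq> univ N"
    using f(2) b by (simp_all add: closed_in_def)
  then obtain B where bB: "insert b (f ` A) \<subseteq> B" and B: "closed_in ?L N B"
    by (rule exists_closed_in_superset[OF nn])
  have AB: "f ` A \<subseteq> B" and finB: "finite B" and BN: "B \<subseteq> univ N"
    using bB B by (simp_all add: closed_in_def)
  define T where "T = edges ?L N B - edges ?L N (f ` A)"
  have finT: "finite T"
    using nn finB BN by (simp add: nonneg_predim_def T_def)
  have T: "length (snd e) = ar (fst e) \<and> set (snd e) \<subseteq> B \<and> \<not> set (snd e) \<subseteq> f ` A" if "e \<in> T" for e
  proof -
    obtain i t where e: "e = (i, t)"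
      by (cases e)
    with that have "t \<in> rels N i"
      unfolding T_def by (simp add: mem_edges)
    then have "legal ?L (ar i) t"
      using genN by (simp add: generic_def is_lstruct_def)
    then show ?thesis
      using that unfolding T_def e by (simp add: mem_edges tuples_kind_def)
  qed
  \<comment> \<open>Any entry outside the old image serves; one exists because the tuple is not
    supported there.\<close>
  define c where "c e = (SOME x. x \<in> set (snd e) - f ` A)" for e :: "'i \<times> 'b list"
  have c: "c e \<in> set (snd e) - f ` A" if "e \<in> T" for e
    unfolding c_def by (rule someI_ex) (use T[OF that] in blast)
  interpret gadget T "\<lambda>e. ar (fst e)" "\<lambda>e. set (snd e)" c B "f ` A"
  proof
    show "card (set (snd e)) \<le> ar (fst e)" if "e \<in> T" for e
      using T[OF that] card_length[of "snd e"] by simp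
  qed (use finT finB AB T c ar in auto)
  let ?W = "Inl ` f ` A :: ('b + ('i \<times> 'b list) \<times> nat) set"
  let ?VB = "Inl ` B :: ('b + ('i \<times> 'b list) \<times> nat) set"
  have WV: "?W \<subseteq> verts" and BV: "?VB \<subseteq> verts"
    using AB by (auto simp: verts_def)
  have supp_tuples: "supp ?L t = set t" for t
    by (simp add: tuples_kind_def)
  have delta_B: "delta ?L N Y = ext_delta (f ` A) (delta ?L N) (\<lambda>e. set (snd e)) T Y" if "Y \<subseteq> B" for Y
    using delta_eq_ext_delta[OF nn finB BN AB that]
    by (simp only: T_def supp_tuples)
  have new_fresh: "Inr j \<in> tuple_supp j" "\<not> tuple_supp j \<subseteq> ?VB" if "j \<in> new_edges" for j
    using that by (auto simp: tuple_supp_def new_edges_def split: if_splits)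
  let ?\<Delta>1 = "ext_delta ?VB (\<lambda>X. delta ?L N (projl ` X)) tuple_supp new_edges"
  \<comment> \<open>Every auxiliary edge \<open>j\<close> contains its own fresh vertex
    \<open>Inr j\<close>, so there are at most as many edges as new vertices. This settles both
    conditions for embedding the enlargement over \<open>B\<close>.\<close>
  have \<Delta>1_ge: "delta ?L N (projl ` (Y \<inter> ?VB)) \<le> ?\<Delta>1 Y" if "Y \<subseteq> verts" for Y
  proof -
    have "card {j \<in> new_edges. tuple_supp j \<subseteq> Y} = card (Inr ` {j \<in> new_edges. tuple_supp j \<subseteq> Y} :: ('b + ('i \<times> 'b list) \<times> nat) set)"
      by (simp add: card_image)
    also have "\<dots> \<le> card (Y - ?VB)"
    proof (rule card_mono)
      show "finite (Y - ?VB)"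
        using finite_subset[OF that finite_verts] by simp
      show "Inr ` {j \<in> new_edges. tuple_supp j \<subseteq> Y} \<subseteq> Y - ?VB"
        using new_fresh(1) by auto
    qed
    finally show ?thesis
      by (simp add: ext_delta_def)
  qed
  \<comment> \<open>Repetitions allow supports of one or two points at any arity: a constant tuple,
    and the fresh point followed by copies of \<open>c e\<close>.\<close>
  let ?E1 = "\<lambda>g (e, k). if k \<le> ar (fst e) then replicate (ar (fst e)) (g (Inr (e, k)))
    else g (Inr (e, k)) # replicate (ar (fst e) - 1) (g (Inl (c e)))"
  have projl_B: "projl ` ?VB = B"
    by (simp add: image_image)
  have "\<exists>h. inj_on h verts \<and> (\<forall>x\<in>?VB. h x = projl x) \<and> closed_in ?L N (h ` verts) \<and>
    (\<forall>Y\<subseteq>verts. delta ?L N (h ` Y) = ?\<Delta>1 Y)"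
  proof (rule tuples.generic_extend[where symb = "\<lambda>j. fst (fst j)" and E = ?E1,
        OF genN finite_verts BV finite_new_edges])
    show "inj_on projl ?VB"
      by (auto simp: inj_on_def)
    show "closed_in ?L N (projl ` ?VB)"
      using B by (simp only: projl_B)
    show "tuple_supp j \<subseteq> verts" "\<not> tuple_supp j \<subseteq> ?VB" if "j \<in> new_edges" for j
      using tuple_supp_verts[OF that] new_fresh[OF that] by simp_all
    show "legal ?L (ar (fst (fst j))) (?E1 g j) \<and> supp ?L (?E1 g j) = g ` tuple_supp j"
      if "inj_on g verts" and j_new: "j \<in> new_edges" for g :: "_ \<Rightarrow> 'b" and j
    proof -
      obtain e k where j: "j = (e, k)" "k \<le> Suc (ar (fst e))"
        using j_new by (auto simp: new_edges_def)
      have "3 \<le> ar (fst e)"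
        by (rule ar)
      then show ?thesis
        using j by (auto simp: tuples_kind_def tuple_supp_def)
    qed
    have "inj_on tuple_supp new_edges"
    proof (rule inj_onI)
      fix j j' assume j: "j \<in> new_edges" "j' \<in> new_edges" and eq: "tuple_supp j = tuple_supp j'"
      have "Inr j \<in> tuple_supp j'" "j' \<in> new_edges"
        using new_fresh(1)[OF j(1)] j(2) by (simp_all only: eq)
      then show "j = j'"
        by (auto simp: tuple_supp_def new_edges_def split: if_splits)
    qed
    then show "inj_on (\<lambda>j. (fst (fst j), tuple_supp j)) new_edges"
      by (auto simp: inj_on_def)
  next
    fix Y assume Y: "Y \<subseteq> verts"
    have sub: "projl ` (Y \<inter> ?VB) \<subseteq> B"
      by auto
    then have "0 \<le> delta ?L N (projl ` (Y \<inter> ?VB))"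
      using nn BN finite_subset[OF sub finB] by (simp add: nonneg_predim_def)
    then show "0 \<le> ?\<Delta>1 Y"
      using \<Delta>1_ge[OF Y] by simp
    show "delta ?L N (projl ` ?VB) \<le> ?\<Delta>1 Y" if "?VB \<subseteq> Y"
      using \<Delta>1_ge[OF Y] that by (simp add: Int_absorb1)
  qed
  then obtain h where h: "inj_on h verts" "\<forall>x\<in>?VB. h x = projl x" "closed_in ?L N (h ` verts)"
    and "\<forall>Y\<subseteq>verts. delta ?L N (h ` Y) = ?\<Delta>1 Y"
    by (elim exE conjE)
  then have delta_h: "delta ?L N (h ` Y)
      = ext_delta ?W (\<lambda>X. delta ?L N (projl ` X)) tuple_supp all_edges Y" if "Y \<subseteq> verts" for Y
    using ext_delta_stages[OF delta_B that] that by simp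
  have h_Inl: "h (Inl x) = x" if "x \<in> B" for x
    using h(2) that by simp
  \<comment> \<open>The base vertices carry the names of points in \<open>N\<close>;
    \<open>g\<close> interprets them in \<open>M\<close>.\<close>
  define g where "g x = inv_into A f (projl x)" for x :: "'b + ('i \<times> 'b list) \<times> nat"
  have g_Inl: "g (Inl (f x)) = x" if "x \<in> A" for x
    using f(1) that by (simp add: g_def)
  have gW: "g ` ?W = A"
    using g_Inl by (simp add: image_image)
  have g: "bij_betw g ?W A"
    unfolding bij_betw_def using gW g_Inl by (auto simp: inj_on_def)
  have projl_g: "f ` g ` X = projl ` X" if "X \<subseteq> ?W" for X
  proof -
    have "f (g x) = projl x" if "x \<in> ?W" for x
      using that g_Inl by auto
    then show ?thesis
      using that unfolding image_image by (intro image_cong) auto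
  qed
  have domW: "dominated ?W (\<lambda>X. delta ?K M (g ` X)) (\<lambda>X. delta ?L N (projl ` X))"
    "dominated ?W (\<lambda>X. delta ?L N (projl ` X)) (\<lambda>X. delta ?K M (g ` X))"
    by (rule dominated_eqI[OF dominated_reindex[OF dom(1) g]]
        dominated_eqI[OF dominated_reindex[OF dom(2) g]]; simp add: projl_g)+
  let ?\<Delta>2 = "ext_delta ?W (\<lambda>X. delta ?K M (g ` X)) set_supp all_edges"
  have "dominated verts ?\<Delta>2 (ext_delta ?W (\<lambda>X. delta ?L N (projl ` X)) tuple_supp all_edges)"
    using dominated_set_tuple dominated_ext_delta[OF domW(1) WV finite_all_edges] by (rule dominated_trans)
  then have dom_MN: "dominated verts ?\<Delta>2 (\<lambda>Y. delta ?L N (h ` Y))"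
    by (rule dominated_eqI[OF _ refl delta_h[symmetric]])
  have "dominated verts (ext_delta ?W (\<lambda>X. delta ?L N (projl ` X)) tuple_supp all_edges) ?\<Delta>2"
    using dominated_ext_delta[OF domW(2) WV finite_all_edges] dominated_tuple_set by (rule dominated_trans)
  then have dom_NM: "dominated verts (\<lambda>Y. delta ?L N (h ` Y)) ?\<Delta>2"
    by (rule dominated_eqI[OF _ delta_h[symmetric] refl])
  have hN: "h ` Y \<subseteq> univ N" "finite (h ` Y)" if "Y \<subseteq> verts" for Y
    using h(3) that finite_subset[OF that finite_verts] image_mono[OF that, of h]
    by (auto simp: closed_in_def)
  have "\<exists>h'. inj_on h' verts \<and> (\<forall>x\<in>?W. h' x = g x) \<and> closed_in ?K M (h' ` verts) \<and>
    (\<forall>Y\<subseteq>verts. delta ?K M (h' ` Y) = ?\<Delta>2 Y)"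
  proof (rule subsets.generic_extend_dominated[where symb = "\<lambda>j. fst (fst j)" and E = "\<lambda>g j. g ` set_supp j",
        OF genM finite_verts WV finite_all_edges _ _ _ _ _ _ dom_MN])
    show "inj_on g ?W" "closed_in ?K M (g ` ?W)"
      using g A by (simp_all only: bij_betw_def gW)
    show "set_supp j \<subseteq> verts" "\<not> set_supp j \<subseteq> ?W" if "j \<in> all_edges" for j
      using set_supp_verts[OF that] set_supp_fresh[OF that] by auto
    show "legal ?K (ar (fst (fst j))) (g' ` set_supp j) \<and> supp ?K (g' ` set_supp j) = g' ` set_supp j"
      if "inj_on g' verts" "j \<in> all_edges" for g' :: "_ \<Rightarrow> 'a" and j
      using card_set_supp[of "fst j" "snd j"] that(2)
        card_image[OF inj_on_subset[OF that(1) set_supp_verts[OF that(2)]]]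
      by (simp add: subsets_kind_def)
    show "inj_on (\<lambda>j. (fst (fst j), set_supp j)) all_edges"
      using inj_on_set_supp by (auto simp: inj_on_def)
    show "0 \<le> delta ?L N (h ` Y)" if "Y \<subseteq> verts" for Y
      using nn hN[OF that] by (simp add: nonneg_predim_def)
    show "delta ?K M (g ` ?W) \<le> delta ?L N (h ` Y)" if Y: "?W \<subseteq> Y" "Y \<subseteq> verts" for Y
    proof -
      have "delta ?K M (g ` ?W) \<le> delta ?L N (f ` A)"
        unfolding gW using dominated_top[OF dom(2)] .
      also have "f ` A \<subseteq> h ` Y"
      proof
        fix x assume x: "x \<in> f ` A"
        then have "Inl x \<in> Y" "h (Inl x) = x"
          using Y(1) AB h_Inl by auto
        then show "x \<in> h ` Y"
          by (metis image_eqI)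
      qed
      then have "delta ?L N (f ` A) \<le> delta ?L N (h ` Y)"
        using f(2) hN[OF Y(2)] by (simp add: closed_in_def)
      finally show ?thesis .
    qed
  qed
  then obtain h' where h': "inj_on h' verts" "\<forall>x\<in>?W. h' x = g x" "closed_in ?K M (h' ` verts)"
    and delta_h': "\<forall>Y\<subseteq>verts. delta ?K M (h' ` Y) = ?\<Delta>2 Y"
    by (elim exE conjE)
  let ?A = "h' ` verts" and ?r = "inv_into verts h'"
  let ?f = "\<lambda>x. h (?r x)"
  have r: "bij_betw ?r ?A verts"
    using h'(1) by (simp add: bij_betw_inv_into inj_on_imp_bij_betw)
  have r_h': "?r (h' x) = x" if "x \<in> verts" for x
    using h'(1) that by simp
  have h'_r: "h' ` ?r ` X = X" if "X \<subseteq> ?A" for X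
    using that by (rule image_inv_into_cancel[OF refl])
  have f_r: "h ` ?r ` X = ?f ` X" for X
    by (simp add: image_image)
  have "dominated verts (\<lambda>Y. delta ?K M (h' ` Y)) (\<lambda>Y. delta ?L N (h ` Y))"
    "dominated verts (\<lambda>Y. delta ?L N (h ` Y)) (\<lambda>Y. delta ?K M (h' ` Y))"
    by (rule dominated_eqI[OF dom_MN] dominated_eqI[OF dom_NM]; simp add: delta_h')+
  note reindexed = dominated_reindex[OF this(1) r] dominated_reindex[OF this(2) r]
  have "dominated ?A (delta ?K M) (\<lambda>X. delta ?L N (?f ` X))"
    by (rule dominated_eqI[OF reindexed(1)]) (simp_all only: h'_r f_r)
  moreover have "dominated ?A (\<lambda>X. delta ?L N (?f ` X)) (delta ?K M)"
    by (rule dominated_eqI[OF reindexed(2)]) (simp_all only: h'_r f_r)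
  moreover have f_A: "?f ` ?A = h ` verts"
    using r by (simp add: f_r[symmetric] bij_betw_def)
  moreover have "inj_on ?f ?A"
    using comp_inj_on[of ?r ?A h] r h(1) by (simp add: bij_betw_def comp_def)
  ultimately have "partial_iso ?K M ?L N ?A ?f"
    using h(3) h'(3) by (simp add: partial_iso_def)
  moreover have A_sub: "x \<in> ?A \<and> ?f x = f x" if "x \<in> A" for x
  proof -
    have v: "Inl (f x) \<in> ?W" "Inl (f x) \<in> verts" "f x \<in> B"
      using that WV AB by auto
    have x: "h' (Inl (f x)) = x"
      using bspec[OF h'(2) v(1)] g_Inl[OF that] by simp
    then have "x \<in> ?A"
      using v(2) by (metis image_eqI)
    moreover have "?r x = Inl (f x)"
      using r_h'[OF v(2)] x by simp
    ultimately show ?thesis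
      using h_Inl[OF v(3)] by simp
  qed
  moreover have "b \<in> ?f ` ?A"
  proof -
    have "b \<in> B"
      using bB by simp
    then have "Inl b \<in> verts" "h (Inl b) = b"
      using BV h_Inl by auto
    then show ?thesis
      unfolding f_A by (metis image_eqI)
  qed
  ultimately show ?thesis
    by (intro exI[of _ ?A] exI[of _ ?f]) auto
qed

section \<open>The limit of a back-and-forth system\<close>

lemma countable_enumeration:
  assumes "countable U"
  shows "\<exists>u :: nat \<Rightarrow> 'a. U \<subseteq> range u"
proof (cases "U = {}")
  case False
  then show ?thesis
    using range_from_nat_into[OF False assms] by (intro exI[of _ "from_nat_into U"]) simp
qed simp

text \<open>Besides the bijection, the conclusion keeps that every finite set lies in a stage on
  which \<open>F\<close> is the local map; this is how dimension passes to the limit.\<close>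

lemma back_and_forth:
  fixes P :: "'a set \<Rightarrow> ('a \<Rightarrow> 'b) \<Rightarrow> bool"
  assumes U: "countable U" "countable U'"
    and start: "P A0 f0"
    and P: "\<And>A f. P A f \<Longrightarrow> A \<subseteq> U \<and> f ` A \<subseteq> U' \<and> inj_on f A"
    and fwd: "\<And>A f a. P A f \<Longrightarrow> a \<in> U \<Longrightarrow>
      \<exists>A' f'. P A' f' \<and> A \<subseteq> A' \<and> (\<forall>x\<in>A. f' x = f x) \<and> a \<in> A'"
    and bwd: "\<And>A f b. P A f \<Longrightarrow> b \<in> U' \<Longrightarrow>
      \<exists>A' f'. P A' f' \<and> A \<subseteq> A' \<and> (\<forall>x\<in>A. f' x = f x) \<and> b \<in> f' ` A'"
  shows "\<exists>F. bij_betw F U U' \<and>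
    (\<forall>X\<subseteq>U. finite X \<longrightarrow> (\<exists>A f. P A f \<and> X \<subseteq> A \<and> (\<forall>x\<in>A. F x = f x)))"
proof -
  obtain u :: "nat \<Rightarrow> 'a" where u: "U \<subseteq> range u"
    using countable_enumeration[OF U(1)] by (elim exE)
  obtain u' :: "nat \<Rightarrow> 'b" where u': "U' \<subseteq> range u'"
    using countable_enumeration[OF U(2)] by (elim exE)
  let ?ext = "\<lambda>p q. fst p \<subseteq> fst q \<and> (\<forall>x\<in>fst p. snd q x = snd p x)"
  have step: "\<exists>q. P (fst q) (snd q) \<and> ?ext p q \<and> (u k \<in> U \<longrightarrow> u k \<in> fst q) \<and>
      (u' k \<in> U' \<longrightarrow> u' k \<in> snd q ` fst q)" if p: "P (fst p) (snd p)" for p k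
  proof -
    have "\<exists>q. P (fst q) (snd q) \<and> ?ext p q \<and> (u k \<in> U \<longrightarrow> u k \<in> fst q)"
    proof (cases "u k \<in> U")
      case True
      obtain A f where "P A f \<and> fst p \<subseteq> A \<and> (\<forall>x\<in>fst p. f x = snd p x) \<and> u k \<in> A"
        using fwd[OF p True] by (elim exE)
      then show ?thesis
        by (intro exI[of _ "(A, f)"]) simp
    next
      case False
      then show ?thesis
        using p by (intro exI[of _ p]) simp
    qed
    then obtain q where q: "P (fst q) (snd q)" "?ext p q" "u k \<in> U \<longrightarrow> u k \<in> fst q"
      by (elim exE conjE) simp
    show ?thesis
    proof (cases "u' k \<in> U'")
      case True
      obtain A f where Af: "P A f \<and> fst q \<subseteq> A \<and> (\<forall>x\<in>fst q. f x = snd q x) \<and> u' k \<in> f ` A"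
        using bwd[OF q(1) True] by (elim exE)
      then have "fst p \<subseteq> A" "\<forall>x\<in>fst p. f x = snd p x" "u k \<in> U \<longrightarrow> u k \<in> A"
        using q(2,3) by auto
      with Af show ?thesis
        by (intro exI[of _ "(A, f)"]) simp
    next
      case False
      then show ?thesis
        using q by (intro exI[of _ q]) simp
    qed
  qed
  obtain p where p_all: "\<forall>k. P (fst (p k)) (snd (p k)) \<and> (?ext (p k) (p (Suc k)) \<and>
      (u k \<in> U \<longrightarrow> u k \<in> fst (p (Suc k))) \<and> (u' k \<in> U' \<longrightarrow> u' k \<in> snd (p (Suc k)) ` fst (p (Suc k))))"
  proof (rule exE[OF dependent_nat_choice])
    show "\<exists>p. P (fst p) (snd p)"
      using start by (intro exI[of _ "(A0, f0)"]) simp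
    show "\<exists>q. P (fst q) (snd q) \<and> (?ext p q \<and> (u k \<in> U \<longrightarrow> u k \<in> fst q) \<and>
      (u' k \<in> U' \<longrightarrow> u' k \<in> snd q ` fst q))" if "P (fst p) (snd p)" for p k
      using that by (rule step)
  qed
  have p: "P (fst (p k)) (snd (p k))" "?ext (p k) (p (Suc k))"
    "u k \<in> U \<Longrightarrow> u k \<in> fst (p (Suc k))"
    "u' k \<in> U' \<Longrightarrow> u' k \<in> snd (p (Suc k)) ` fst (p (Suc k))" for k
    using spec[OF p_all, of k] by simp_all
  define A where "A k = fst (p k)" for k
  define f where "f k = snd (p k)" for k
  have PA: "P (A k) (f k)" for k
    using p(1) by (simp add: A_def f_def)
  have ext: "A k \<subseteq> A l \<and> (\<forall>x\<in>A k. f l x = f k x)" if "k \<le> l" for k l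
    using that
  proof (induction rule: dec_induct)
    case (step m)
    then show ?case
      using p(2)[of m] by (auto simp: A_def f_def)
  qed simp
  \<comment> \<open>Later stages extend earlier ones, so the first stage containing \<open>x\<close>
    gives the same value as any other.\<close>
  define F where "F x = f (LEAST k. x \<in> A k) x" for x
  have F: "F x = f k x" if "x \<in> A k" for x k
  proof -
    have "x \<in> A (LEAST k. x \<in> A k)" "(LEAST k. x \<in> A k) \<le> k"
      using that by (auto intro: LeastI Least_le)
    then show ?thesis
      using ext unfolding F_def by metis
  qed
  have fin: "\<exists>k. X \<subseteq> A k" if "finite X" "X \<subseteq> U" for X
    using that
  proof (induction rule: finite_induct)
    case (insert x X)
    then obtain k where k: "X \<subseteq> A k" by auto
    obtain l where "x = u l"
      using insert.prems u by auto
    then have "x \<in> A (Suc l)"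
      using p(3)[of l] insert.prems by (simp add: A_def)
    then have "insert x X \<subseteq> A (max k (Suc l))"
      using k ext[of k "max k (Suc l)"] ext[of "Suc l" "max k (Suc l)"] by auto
    then show ?case by blast
  qed simp
  have "inj_on F U"
  proof (rule inj_onI)
    fix x y assume xy: "x \<in> U" "y \<in> U" "F x = F y"
    then obtain k where "{x, y} \<subseteq> A k"
      using fin[of "{x, y}"] by auto
    then show "x = y"
      using P[OF PA[of k]] F[of x k] F[of y k] xy(3) by (auto simp: inj_on_def)
  qed
  moreover have "F ` U = U'"
  proof (intro equalityI subsetI)
    fix y assume "y \<in> F ` U"
    then obtain x where x: "x \<in> U" "y = F x" by blast
    then obtain k where "x \<in> A k"
      using fin[of "{x}"] by auto
    then show "y \<in> U'"
      using P[OF PA[of k]] F x(2) by auto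
  next
    fix y assume y: "y \<in> U'"
    then obtain k where "y = u' k"
      using u' by auto
    then obtain x where x: "x \<in> A (Suc k)" "y = f (Suc k) x"
      using p(4)[of k] y by (auto simp: A_def f_def)
    then have "x \<in> U" "y = F x"
      using P[OF PA[of "Suc k"]] F[OF x(1)] by auto
    then show "y \<in> F ` U"
      by (intro image_eqI)
  qed
  ultimately have "bij_betw F U U'"
    by (simp add: bij_betw_def)
  moreover have "\<exists>A f. P A f \<and> X \<subseteq> A \<and> (\<forall>x\<in>A. F x = f x)" if X: "X \<subseteq> U" "finite X" for X
  proof -
    obtain k where "X \<subseteq> A k"
      using fin[OF X(2,1)] by (elim exE)
    then show ?thesis
      using PA[of k] F by (intro exI[of _ "A k"] exI[of _ "f k"]) simp
  qed
  ultimately show ?thesis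
    by (intro exI[of _ F]) simp
qed

section \<open>From dimensions to geometries\<close>

text \<open>A set attaining the dimension of \<open>X\<close> may be cut down to \<open>A\<close>
  without raising its predimension, since \<open>A\<close> is self-sufficient; domination then
  carries the bound to the other side. The converse is symmetric.\<close>

lemma partial_iso_dim:
  assumes nn: "nonneg_predim K M" "nonneg_predim L N"
    and iso: "partial_iso K M L N A f" and X: "X \<subseteq> A"
  shows "dim L N (f ` X) = dim K M X"
proof -
  have A: "closed_in K M A" and f: "inj_on f A" "closed_in L N (f ` A)"
    and dom: "dominated A (delta K M) (\<lambda>X. delta L N (f ` X))"
      "dominated A (\<lambda>X. delta L N (f ` X)) (delta K M)"
    using iso by (simp_all add: partial_iso_def)
  have AM: "finite A" "A \<subseteq> univ M" and fAN: "f ` A \<subseteq> univ N"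
    using A f(2) by (simp_all add: closed_in_def)
  have XM: "finite X" "X \<subseteq> univ M" and fXN: "finite (f ` X)" "f ` X \<subseteq> univ N"
    using finite_subset[OF X AM(1)] order_trans[OF X AM(2)] order_trans[OF image_mono[OF X] fAN]
    by simp_all
  show ?thesis
  proof (rule antisym)
    obtain Y where Y: "finite Y" "X \<subseteq> Y" "Y \<subseteq> univ M" "dim K M X = delta K M Y"
      using dim_attained(1)[OF nn(1) XM] by (elim exE conjE)
    obtain Z where Z: "Y \<inter> A \<subseteq> Z" "Z \<subseteq> A" "delta L N (f ` Z) \<le> delta K M (Y \<inter> A)"
      using dom(1) Int_lower2 by (rule dominatedE)
    have XZ: "X \<subseteq> Z"
      using X Y(2) Z(1) by blast
    have "dim L N (f ` X) \<le> delta L N (f ` Z)"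
      by (rule dim_attained(2)[OF nn(2) fXN _ image_mono[OF XZ]
        order_trans[OF image_mono[OF Z(2)] fAN]])
        (simp add: finite_subset[OF Z(2) AM(1)])
    then show "dim L N (f ` X) \<le> dim K M X"
      using Z(3) closed_in_Int[OF nn(1) A Y(1,3)] Y(4) by simp
  next
    obtain Y where Y: "finite Y" "f ` X \<subseteq> Y" "Y \<subseteq> univ N" "dim L N (f ` X) = delta L N Y"
      using dim_attained(1)[OF nn(2) fXN] by (elim exE conjE)
    let ?Y = "{x \<in> A. f x \<in> Y}"
    have YA: "f ` ?Y = Y \<inter> f ` A"
      by auto
    obtain Z where Z: "?Y \<subseteq> Z" "Z \<subseteq> A" "delta K M Z \<le> delta L N (f ` ?Y)"
      using dom(2) Collect_restrict by (rule dominatedE)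
    have XZ: "X \<subseteq> Z"
      using X Y(2) Z(1) by blast
    have "dim K M X \<le> delta K M Z"
      by (rule dim_attained(2)[OF nn(1) XM finite_subset[OF Z(2) AM(1)] XZ order_trans[OF Z(2) AM(2)]])
    then show "dim K M X \<le> dim L N (f ` X)"
      using Z(3) closed_in_Int[OF nn(2) f(2) Y(1,3)] Y(4) unfolding YA by simp
  qed
qed

text \<open>Closure is determined by the dimensions of finite sets, so \<open>F\<close> carries
  closures to closures, and taking images under \<open>F\<close> is the isomorphism on
  points.\<close>

lemma geom_iso_if_dim_eq:
  assumes F: "bij_betw F (univ M) (univ N)"
    and dim: "\<And>X. X \<subseteq> univ M \<Longrightarrow> finite X \<Longrightarrow> dim L N (F ` X) = dim K M X"
  shows "geom_iso (geom K M) (geom L N)"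
proof -
  have inj: "inj_on F (univ M)" and surj: "F ` univ M = univ N"
    using F by (auto simp: bij_betw_def)
  have cl_fin: "cl_fin L N (F ` X) = F ` cl_fin K M X" if X: "X \<subseteq> univ M" "finite X" for X
  proof -
    have eq: "F c \<in> cl_fin L N (F ` X) \<longleftrightarrow> c \<in> cl_fin K M X" if c: "c \<in> univ M" for c
      using dim[of "insert c X"] dim[OF X] X c surj by (auto simp: cl_fin_def)
    show ?thesis
    proof (intro equalityI subsetI)
      fix y assume y: "y \<in> cl_fin L N (F ` X)"
      then obtain c where "c \<in> univ M" "y = F c"
        using surj by (auto simp: cl_fin_def)
      then show "y \<in> F ` cl_fin K M X"
        using y eq by blast
    next
      fix y assume "y \<in> F ` cl_fin K M X"
      then obtain c where "c \<in> cl_fin K M X" "y = F c" by blast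
      moreover from this have "c \<in> univ M" by (simp add: cl_fin_def)
      ultimately show "y \<in> cl_fin L N (F ` X)"
        using eq by blast
    qed
  qed
  have cl_univ: "cl K M X \<subseteq> univ M" for X
    by (auto simp: cl_def cl_fin_def)
  have cl: "cl L N (F ` X) = F ` cl K M X" if X: "X \<subseteq> univ M" for X
  proof (cases "finite X")
    case True
    then show ?thesis
      using cl_fin[OF X] by (simp add: cl_def)
  next
    case False
    moreover have "infinite (F ` X)"
      using False finite_imageD inj_on_subset[OF inj X] by blast
    moreover have "{Y. finite Y \<and> Y \<subseteq> F ` X} = (`) F ` {Y. finite Y \<and> Y \<subseteq> X}"
    proof (intro equalityI subsetI)
      fix Z assume "Z \<in> {Y. finite Y \<and> Y \<subseteq> F ` X}"
      then obtain Y where "Y \<subseteq> X" "finite Y" "Z = F ` Y"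
        using finite_subset_image[of Z F X] by auto
      then show "Z \<in> (`) F ` {Y. finite Y \<and> Y \<subseteq> X}"
        by (intro image_eqI[of _ _ Y]) simp_all
    qed auto
    moreover have "(\<Union>Y\<in>{Y. finite Y \<and> Y \<subseteq> X}. cl_fin L N (F ` Y))
        = (\<Union>Y\<in>{Y. finite Y \<and> Y \<subseteq> X}. F ` cl_fin K M Y)"
      using cl_fin X by (intro SUP_cong) auto
    ultimately show ?thesis
      by (simp add: cl_def image_UN)
  qed
  have point: "F ` (cl K M {x} - cl K M {}) = cl L N {F x} - cl L N {}" if "x \<in> univ M" for x
    using cl[of "{x}"] cl[of "{}"] that
      inj_on_image_set_diff[OF inj order_trans[OF Diff_subset cl_univ] cl_univ]
    by simp
  have not_loop: "F x \<notin> cl L N {} \<longleftrightarrow> x \<notin> cl K M {}" if "x \<in> univ M" for x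
    using cl[of "{}"] inj_on_image_mem_iff[OF inj that cl_univ] by simp
  have points_sub: "p \<subseteq> univ M" if "p \<in> geom_points K M" for p
    using that cl_univ by (auto simp: geom_points_def)
  have image_points: "(`) F ` geom_points K M = geom_points L N"
  proof (intro equalityI subsetI)
    fix q assume "q \<in> (`) F ` geom_points K M"
    then obtain x where x: "x \<in> univ M" "x \<notin> cl K M {}" "q = F ` (cl K M {x} - cl K M {})"
      by (auto simp: geom_points_def)
    then show "q \<in> geom_points L N"
      using point not_loop surj unfolding geom_points_def by blast
  next
    fix q assume "q \<in> geom_points L N"
    then obtain y where y: "y \<in> univ N" "y \<notin> cl L N {}" "q = cl L N {y} - cl L N {}"
      by (auto simp: geom_points_def)
    then obtain x where x: "x \<in> univ M" "y = F x"
      using surj by blast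
    then have "q = F ` (cl K M {x} - cl K M {})" "x \<notin> cl K M {}"
      using y point not_loop by simp_all
    then show "q \<in> (`) F ` geom_points K M"
      using x(1) unfolding geom_points_def by blast
  qed
  have "inj_on ((`) F) (geom_points K M)"
    by (rule inj_onI) (metis inj_on_image_eq_iff[OF inj] points_sub)
  then have "bij_betw ((`) F) (geom_points K M) (geom_points L N)"
    using image_points by (simp add: bij_betw_def)
  moreover have "(`) F ` {p \<in> geom_points K M. p \<subseteq> cl K M (\<Union>P)}
      = {q \<in> geom_points L N. q \<subseteq> cl L N (\<Union>((`) F ` P))}" if P: "P \<subseteq> geom_points K M" for P
  proof -
    have UP: "\<Union>P \<subseteq> univ M"
      using P points_sub by blast
    have "\<Union>((`) F ` P) = F ` \<Union>P"
      by blast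
    then have "cl L N (\<Union>((`) F ` P)) = F ` cl K M (\<Union>P)"
      using cl[OF UP] by simp
    moreover have "F ` p \<subseteq> F ` cl K M (\<Union>P) \<longleftrightarrow> p \<subseteq> cl K M (\<Union>P)" if "p \<in> geom_points K M" for p
      using inj_on_image_subset_iff[OF inj points_sub[OF that] cl_univ] .
    ultimately show ?thesis
      unfolding image_points[symmetric] by auto
  qed
  ultimately show ?thesis
    unfolding geom_iso_def geom_def by (intro exI[of _ "(`) F"]) simp
qed

theorem theorem4p7:
  fixes ar :: "'i \<Rightarrow> nat"
    and M :: "('a::infinite, 'i, 'a set) lstruct"
    and M_hat :: "('b::infinite, 'i, 'b list) lstruct"
  assumes "\<forall>i. 3 \<le> ar i"
    and "\<forall>k. finite {i. ar i = k}"
    and "generic subsets_kind ar M"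
    and "generic tuples_kind ar M_hat"
  shows "geom_iso (geom subsets_kind M) (geom tuples_kind M_hat)"
proof -
  let ?K = "subsets_kind :: ('a, 'a set) kind" and ?L = "tuples_kind :: ('b, 'b list) kind"
  let ?P = "partial_iso ?K M ?L M_hat"
  have nn: "nonneg_predim ?K M" "nonneg_predim ?L M_hat"
    using assms(3,4) by (simp_all add: generic_nonneg_predim)
  \<comment> \<open>The empty sets are self-sufficient and both have predimension 0.\<close>
  have start: "?P {} f" for f
    using nn by (simp add: partial_iso_def closed_in_empty dominated_def delta_empty)
  have "\<exists>F. bij_betw F (univ M) (univ M_hat) \<and> (\<forall>X\<subseteq>univ M. finite X \<longrightarrow>
      (\<exists>A f. ?P A f \<and> X \<subseteq> A \<and> (\<forall>x\<in>A. F x = f x)))"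
  proof (rule back_and_forth[where P = ?P, OF _ _ start])
    show "countable (univ M)" "countable (univ M_hat)"
      using assms(3,4) by (simp_all add: generic_def)
    show "A \<subseteq> univ M \<and> f ` A \<subseteq> univ M_hat \<and> inj_on f A" if "?P A f" for A f
      using that by (simp add: partial_iso_def closed_in_def)
    show "\<exists>A' f'. ?P A' f' \<and> A \<subseteq> A' \<and> (\<forall>x\<in>A. f' x = f x) \<and> a \<in> A'"
      if "?P A f" "a \<in> univ M" for A f a
      using assms(3,4) that by (rule partial_iso_forth)
    show "\<exists>A' f'. ?P A' f' \<and> A \<subseteq> A' \<and> (\<forall>x\<in>A. f' x = f x) \<and> b \<in> f' ` A'"
      if "?P A f" "b \<in> univ M_hat" for A f b
      using spec[OF assms(1)] assms(3,4) that by (rule partial_iso_back)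
  qed
  then obtain F where F: "bij_betw F (univ M) (univ M_hat)"
    and local_iso: "\<forall>X\<subseteq>univ M. finite X \<longrightarrow> (\<exists>A f. ?P A f \<and> X \<subseteq> A \<and> (\<forall>x\<in>A. F x = f x))"
    by (elim exE conjE)
  have "dim ?L M_hat (F ` X) = dim ?K M X" if X: "X \<subseteq> univ M" "finite X" for X
  proof -
    have "\<exists>A f. ?P A f \<and> X \<subseteq> A \<and> (\<forall>x\<in>A. F x = f x)"
      using local_iso X by simp
    then obtain A f where iso: "?P A f" and A: "X \<subseteq> A" "\<forall>x\<in>A. F x = f x"
      by (elim exE conjE)
    have "F ` X = f ` X"
      using A by (intro image_cong) auto
    then show ?thesis
      using partial_iso_dim[OF nn iso A(1)] by simp
  qed
  with F show ?thesis
    by (rule geom_iso_if_dim_eq)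
qed

end
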